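(* Let $B>1$, let $N\ge2$ be an integer, and let $(X_n)_{n\ge0}$ be the nearest neighbour walk on $\{0,1,2,\dots\}$ with $p_R=\frac{B}{4R}$ (in the sense described in the context). For $\varepsilon\ge0$ and $R$ large enough that the iterated logarithms are defined, put $$f(N,R,\varepsilon)=\frac1{\log 2}\Big(\sum_{j=2}^{N}\log_jR+\varepsilon\log_NR\Big),\qquad g(N,R)=f(N,R,0)=\frac{1}{\log 2}\sum_{j=2}^N\log_j R .$$ Then: (1) With probability $1$ there exist infinitely many $R$ for which $\xi(R+j,\infty)=1$ for each $j=0,1,2,\dots,[g(N,R)]$. (2) With probability $1$, for any $\varepsilon>0$ and all $R$ large enough there exists an integer $S$ with $$R\le S\le R+f(N,R,\varepsilon)$$ such that $\xi(S,\infty)>1$.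
   Context: Walk: for $0\le p_i<1/2$, $i\ge1$, $(X_n)_{n\ge0}$ is the Markov chain on $\{0,1,2,\dots\}$ with $X_0=0$ and $\mathbf P(X_{n+1}=i+1\mid X_n=i)=1-\mathbf P(X_{n+1}=i-1\mid X_n=i)=E_i$, where $E_0=1$ and $E_i=1/2+p_i$ for $i\ge1$. Convention: "$p_i=\frac{B}{4i}$" means: let $i_0=\min\{i\ge1:\frac{B}{4i}<\frac12\}$; then $p_i=\frac{B}{4i}$ for $i\ge i_0$ and $p_i=p_{i_0}$ for $1\le i\le i_0$. Local time: $\xi(x,\infty)=\#\{k\ge0:X_k=x\}$. Iterated logarithms: $\log_1R=\log R$, $\log_kR=\log\log_{k-1}R$ (natural logarithm). $[\cdot]$ denotes integer part. *)

theory Defs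
  imports "HOL-Probability.Probability" "HOL-Library.Extended_Nat"
begin

definition up_prob :: "(nat \<Rightarrow> real) \<Rightarrow> nat \<Rightarrow> real" where
  "up_prob p i = (if i = 0 then 1 else 1 / 2 + p i)"

definition step_prob :: "(nat \<Rightarrow> real) \<Rightarrow> nat \<Rightarrow> nat \<Rightarrow> real" where
  "step_prob p i j =
     (if j = i + 1 then up_prob p i else if j + 1 = i then 1 - up_prob p i else 0)"

text \<open>
  In \<open>markov\<close> the function \<open>x\<close> runs through all deterministic trajectories; only
  \<open>x 0, \<dots>, x (Suc n)\<close> matter. Conditional probabilities are constrained only
  where the conditioning event has positive probability.
\<close>

locale nn_walk = prob_space M
  for M :: "'a measure" and p :: "nat \<Rightarrow> real" and X :: "nat \<Rightarrow> 'a \<Rightarrow> nat" +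
  assumes measurable_X [measurable]: "\<And>n. X n \<in> measurable M (count_space UNIV)"
    and start: "AE \<omega> in M. X 0 \<omega> = 0"
    and markov: "\<And>n x. \<P>(\<omega> in M. \<forall>k\<le>n. X k \<omega> = x k) > 0 \<Longrightarrow>
      \<P>(\<omega> in M. X (Suc n) \<omega> = x (Suc n) \<bar> \<forall>k\<le>n. X k \<omega> = x k)
        = step_prob p (x n) (x (Suc n))"

definition drift :: "real \<Rightarrow> nat \<Rightarrow> real" where
  "drift B i =
     (let i0 = (LEAST i. 1 \<le> i \<and> B / (4 * real i) < 1 / 2)
      in if i0 \<le> i then B / (4 * real i) else B / (4 * real i0))"

text \<open>The value of \<open>drift B 0\<close> is irrelevant, as \<^const>\<open>up_prob\<close> ignores it.\<close>

lemma drift_bounds: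
  assumes "B \<ge> 0" "i \<ge> 1"
  shows "0 \<le> drift B i" "drift B i < 1 / 2"
proof -
  define P where "P = (\<lambda>i::nat. 1 \<le> i \<and> B / (4 * real i) < 1 / 2)"
  define i0 where "i0 = (LEAST i. P i)"
  obtain m :: nat where "real m > B" using reals_Archimedean2 by blast
  with assms have "P (Suc m)" by (simp add: P_def field_simps)
  then have i0: "P i0" unfolding i0_def by (rule LeastI)
  have eq: "drift B i = B / (4 * real (max i i0))"
    by (simp add: drift_def Let_def i0_def P_def max_def)
  show "0 \<le> drift B i" using assms by (simp add: eq)
  have "drift B i \<le> B / (4 * real i0)"
    unfolding eq using assms i0 by (intro divide_left_mono) (auto simp: P_def)
  then show "drift B i < 1 / 2" using i0 by (simp add: P_def)
qed

definition local_time :: "(nat \<Rightarrow> 'a \<Rightarrow> nat) \<Rightarrow> nat \<Rightarrow> 'a \<Rightarrow> enat" where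
  "local_time X x \<omega> =
     (if finite {k. X k \<omega> = x} then enat (card {k. X k \<omega> = x}) else \<infinity>)"

definition iter_log :: "nat \<Rightarrow> real \<Rightarrow> real" where
  "iter_log k = (ln ^^ k)"

text \<open>
  The iterated logarithms below have their usual meaning only for large \<open>R\<close>; for the
  finitely many remaining \<open>R\<close> the values are an artefact of the total function \<^const>\<open>ln\<close>.
\<close>

definition run_f :: "nat \<Rightarrow> nat \<Rightarrow> real \<Rightarrow> real" where
  "run_f N R \<epsilon> =
     1 / ln 2 * ((\<Sum>j=2..N. iter_log j (real R)) + \<epsilon> * iter_log N (real R))"

definition run_g :: "nat \<Rightarrow> nat \<Rightarrow> real" where
  "run_g N R = run_f N R 0"

end

theory Submission
  imports Defs
begin

text \<open>
  Let \<open>r k\<close> be the product of the odds \<open>(1 - E i) / E i\<close> for \<open>1 \<le> i \<le> k\<close> and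
  \<open>T n\<close> the tail sum of \<open>r\<close> from \<open>n\<close> on; \<open>T\<close> is harmonic off \<open>0\<close>, and for the drift
  \<open>B / (4 i)\<close> it satisfies \<open>2 (B - 1) T n = (2 n + B) r n\<close> exactly, for large \<open>n\<close>.
  The sites \<open>R, \<dots>, R + L\<close> are all visited just once iff the path never falls below a
  barrier that depends only on its running maximum. Between the first visits to \<open>z\<close> and to
  \<open>z + 1\<close> the walk makes an excursion independent of the past, so the probability of staying
  above a barrier is a product over the levels \<open>z\<close>. For a run of length \<open>L\<close> it is of the order
  of \<open>2 powr (- L) / R\<close>; for \<open>L = run_f N R \<epsilon>\<close> this is \<open>1 / (R log_1 R \<dots> log_{N-1} R)\<close>
  times \<open>(log_{N-1} R) powr (- \<epsilon>)\<close>, which is summable iff \<open>\<epsilon> > 0\<close>. Part (2) is the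
  first Borel-Cantelli lemma. In part (1) the runs at \<open>R\<close> and at a later \<open>S\<close> have correlation
  ratio \<open>T R' / (T R' - T S)\<close> with \<open>R' = R + L\<close>, which tends to \<open>1\<close> as \<open>S / R\<close> grows, while the pairs with
  \<open>S / R\<close> bounded contribute only linearly; so Chebyshev's inequality gives infinitely many runs.
\<close>

section \<open>A second moment Borel-Cantelli lemma\<close>

text \<open>Chebyshev's inequality: the number of occurrences among the first \<open>n\<close>
  events has mean tending to infinity and a standard deviation that is eventually an arbitrarily
  small fraction of it, so it is unlikely to stay below a fixed bound.\<close>

lemma (in prob_space) AE_infinitely_often_second_moment:
  fixes A :: "nat \<Rightarrow> 'a set"
  assumes [measurable]: "\<And>n. A n \<in> events"
    and diverges: "\<not> summable (\<lambda>n. prob (A n))"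
    and correlation: "\<And>\<delta>. 0 < \<delta> \<Longrightarrow> \<exists>C. \<forall>n. (\<Sum>i<n. \<Sum>j<n. prob (A i \<inter> A j))
        \<le> (1 + \<delta>) * (\<Sum>i<n. prob (A i))\<^sup>2 + C * (\<Sum>i<n. prob (A i))"
  shows "AE \<omega> in M. infinite {n. \<omega> \<in> A n}"
proof -
  define \<mu> where "\<mu> n = (\<Sum>i<n. prob (A i))" for n
  define Z where "Z n \<omega> = (\<Sum>i<n. indicator (A i) \<omega> :: real)" for n \<omega>
  have [measurable]: "Z n \<in> borel_measurable M" for n unfolding Z_def by measurable
  have int_Z: "integrable M (Z n)" for n
    unfolding Z_def by (auto simp: less_top[symmetric])
  have Z_sq: "(Z n \<omega>)\<^sup>2 = (\<Sum>i<n. \<Sum>j<n. indicator (A i \<inter> A j) \<omega>)" for n \<omega>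
    by (simp add: Z_def power2_eq_square sum_product indicator_inter_arith)
  have int_Z2: "integrable M (\<lambda>\<omega>. (Z n \<omega>)\<^sup>2)" for n
    unfolding Z_sq by (auto simp: less_top[symmetric])
  have exp_Z: "expectation (Z n) = \<mu> n" for n
    unfolding Z_def \<mu>_def by (subst Bochner_Integration.integral_sum) (auto simp: less_top[symmetric])
  have exp_Z2: "expectation (\<lambda>\<omega>. (Z n \<omega>)\<^sup>2) = (\<Sum>i<n. \<Sum>j<n. prob (A i \<inter> A j))" for n
    unfolding Z_sq by (subst Bochner_Integration.integral_sum; simp add: less_top[symmetric])+
  have unbounded: "\<exists>n. K \<le> \<mu> n" for K
  proof (rule ccontr)
    assume "\<not> ?thesis"
    then have "summable (\<lambda>n. prob (A n))"
      by (intro bounded_imp_summable[where B = K])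
         (auto simp: \<mu>_def not_le less_imp_le simp flip: lessThan_Suc_atMost simp del: sum.lessThan_Suc)
    with diverges show False by simp
  qed
  \<comment> \<open>Only finitely many events occur exactly on the union of the \<open>B k\<close>,
    so it suffices that each \<open>B k\<close> is null.\<close>
  define B where "B k = {\<omega>\<in>space M. \<forall>n. Z n \<omega> \<le> real k}" for k
  have [measurable]: "B k \<in> events" for k unfolding B_def by measurable
  have "prob (B k) \<le> \<eta>" if "0 < \<eta>" for k \<eta>
  proof -
    \<comment> \<open>At distance \<open>\<mu> n / 2\<close> Chebyshev's inequality leaves room for
      a variance of a quarter of \<open>\<eta>\<close> times the squared mean. Half of this goes to
      the correlations, half to the linear term, which is small enough once \<open>\<mu> n\<close>
      exceeds \<open>8 * \<bar>C\<bar> / \<eta>\<close>.\<close>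
    obtain C where C: "\<And>n. (\<Sum>i<n. \<Sum>j<n. prob (A i \<inter> A j)) \<le> (1 + \<eta> / 8) * (\<mu> n)\<^sup>2 + C * \<mu> n"
      using correlation[of "\<eta> / 8"] \<open>0 < \<eta>\<close> by (auto simp: \<mu>_def)
    obtain n where n: "max (2 * real k + 1) (8 * \<bar>C\<bar> / \<eta>) \<le> \<mu> n" using unbounded by blast
    then have pos: "0 < \<mu> n" and k: "2 * real k < \<mu> n" and "8 * \<bar>C\<bar> \<le> \<eta> * \<mu> n"
      using \<open>0 < \<eta>\<close> by (auto simp: field_simps)
    then have "8 * C \<le> \<eta> * \<mu> n" by linarith
    then have *: "8 * C * \<mu> n \<le> \<eta> * (\<mu> n)\<^sup>2"
      using mult_right_mono[of "8 * C" "\<eta> * \<mu> n" "\<mu> n"] pos by (simp add: power2_eq_square)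
    have "variance (Z n) \<le> \<eta> / 8 * (\<mu> n)\<^sup>2 + C * \<mu> n"
      using C[of n] by (subst variance_eq[OF int_Z int_Z2]) (simp add: exp_Z exp_Z2 algebra_simps)
    also have "\<dots> \<le> \<eta> * (\<mu> n / 2)\<^sup>2"
      using * by (simp add: power2_eq_square algebra_simps)
    finally have var: "variance (Z n) \<le> \<eta> * (\<mu> n / 2)\<^sup>2" .
    have "prob (B k) \<le> prob {\<omega>\<in>space M. \<bar>Z n \<omega> - expectation (Z n)\<bar> \<ge> \<mu> n / 2}"
    proof (intro finite_measure_mono)
      show "B k \<subseteq> {\<omega>\<in>space M. \<bar>Z n \<omega> - expectation (Z n)\<bar> \<ge> \<mu> n / 2}"
      proof
        fix \<omega> assume "\<omega> \<in> B k"
        then have "\<omega> \<in> space M" "Z n \<omega> \<le> real k" by (auto simp: B_def)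
        then show "\<omega> \<in> {\<omega>\<in>space M. \<bar>Z n \<omega> - expectation (Z n)\<bar> \<ge> \<mu> n / 2}"
          using k by (simp add: exp_Z)
      qed
    qed measurable
    also have "\<dots> \<le> variance (Z n) / (\<mu> n / 2)\<^sup>2"
      using pos by (intro Chebyshev_inequality int_Z2) auto
    also have "\<dots> \<le> \<eta>" using var pos by (simp add: pos_divide_le_eq)
    finally show ?thesis .
  qed
  then have "prob (B k) \<le> 0" for k by (rule field_le_epsilon) simp
  then have "B k \<in> null_sets M" for k
    by (auto simp: measure_le_0_iff null_sets_def emeasure_eq_measure)
  then have "AE \<omega> in M. \<forall>k. \<omega> \<notin> B k" by (auto simp: AE_all_countable intro: AE_not_in)
  then show ?thesis
    using AE_space
  proof eventually_elim
    case (elim \<omega>)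
    show ?case
    proof
      assume fin: "finite {n. \<omega> \<in> A n}"
      have "Z n \<omega> \<le> real (card {n. \<omega> \<in> A n})" for n
      proof -
        have "Z n \<omega> = (\<Sum>i\<in>{..<n} \<inter> {n. \<omega> \<in> A n}. 1)"
          unfolding Z_def by (subst sum.inter_restrict) (auto intro!: sum.cong)
        also have "\<dots> = real (card ({..<n} \<inter> {n. \<omega> \<in> A n}))" by simp
        also have "\<dots> \<le> real (card {n. \<omega> \<in> A n})" using fin by (simp add: card_mono)
        finally show ?thesis .
      qed
      then have "\<omega> \<in> B (card {n. \<omega> \<in> A n})" using elim by (simp add: B_def)
      with elim show False by blast
    qed
  qed
qed

text \<open>Bounds for ordered pairs suffice: the error \<open>h i j + h j i\<close> covers both
  orders and adds up to at most \<open>2 * C\<close> times the mean count, which the second moment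
  criterion tolerates.\<close>

lemma (in prob_space) AE_infinitely_often_weak_correlation:
  fixes A :: "nat \<Rightarrow> 'a set"
  assumes [measurable]: "\<And>n. A n \<in> events"
    and diverges: "\<not> summable (\<lambda>n. prob (A n))"
    and correlation: "\<And>\<delta>. 0 < \<delta> \<Longrightarrow> \<exists>h C. (\<forall>i j. 0 \<le> h i j) \<and>
        (\<forall>i j. i \<le> j \<longrightarrow> prob (A i \<inter> A j) \<le> (1 + \<delta>) * prob (A i) * prob (A j) + h i j) \<and>
        (\<forall>n. (\<Sum>i<n. \<Sum>j<n. h i j) \<le> C * (\<Sum>i<n. prob (A i)))"
  shows "AE \<omega> in M. infinite {n. \<omega> \<in> A n}"
proof (rule AE_infinitely_often_second_moment)
  fix \<delta> :: real assume "0 < \<delta>"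
  then obtain h C where h: "\<And>i j. 0 \<le> h i j"
      "\<And>i j. i \<le> j \<Longrightarrow> prob (A i \<inter> A j) \<le> (1 + \<delta>) * prob (A i) * prob (A j) + h i j"
      "\<And>n. (\<Sum>i<n. \<Sum>j<n. h i j) \<le> C * (\<Sum>i<n. prob (A i))"
    using correlation[of \<delta>] by blast
  have sym: "prob (A i \<inter> A j) \<le> (1 + \<delta>) * (prob (A i) * prob (A j)) + (h i j + h j i)" for i j
  proof (cases "i \<le> j")
    case True
    then show ?thesis using h(2)[OF True] h(1)[of j i] by simp
  next
    case False
    then show ?thesis using h(2)[of j i] h(1)[of i j] by (simp add: Int_commute mult_ac)
  qed
  have "(\<Sum>i<n. \<Sum>j<n. prob (A i \<inter> A j)) \<le> (1 + \<delta>) * (\<Sum>i<n. prob (A i))\<^sup>2 + (2 * C) * (\<Sum>i<n. prob (A i))" for n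
  proof -
    have "(\<Sum>i<n. \<Sum>j<n. prob (A i \<inter> A j))
        \<le> (\<Sum>i<n. \<Sum>j<n. (1 + \<delta>) * (prob (A i) * prob (A j)) + (h i j + h j i))"
      by (intro sum_mono sym)
    also have "\<dots> = (1 + \<delta>) * (\<Sum>i<n. prob (A i))\<^sup>2 + ((\<Sum>i<n. \<Sum>j<n. h i j) + (\<Sum>i<n. \<Sum>j<n. h j i))"
      by (simp only: sum.distrib power2_eq_square sum_product flip: sum_distrib_left)
    also have "(\<Sum>i<n. \<Sum>j<n. h j i) = (\<Sum>i<n. \<Sum>j<n. h i j)" by (rule sum.swap)
    finally show ?thesis using h(3)[of n] by linarith
  qed
  then show "\<exists>C. \<forall>n. (\<Sum>i<n. \<Sum>j<n. prob (A i \<inter> A j))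
        \<le> (1 + \<delta>) * (\<Sum>i<n. prob (A i))\<^sup>2 + C * (\<Sum>i<n. prob (A i))" by blast
qed (use assms in auto)

section \<open>Iterated logarithms\<close>

lemma iter_log_0 [simp]: "iter_log 0 x = x"
  by (simp add: iter_log_def)

lemma iter_log_Suc: "iter_log (Suc k) x = ln (iter_log k x)"
  by (simp add: iter_log_def)

lemma filterlim_iter_log: "filterlim (iter_log k) at_top at_top"
proof (induction k)
  case (Suc k)
  then show ?case
    using filterlim_compose[OF ln_at_top Suc] by (simp add: iter_log_Suc[abs_def])
qed (simp add: iter_log_def filterlim_ident)

lemma filterlim_iter_log_nat: "filterlim (\<lambda>n. iter_log k (real n)) at_top sequentially"
  by (rule filterlim_compose[OF filterlim_iter_log filterlim_real_sequentially])

lemma eventually_iter_log_pos: "\<forall>\<^sub>F n in sequentially. \<forall>j\<le>N. c < iter_log j (real n)"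
proof -
  have "\<forall>\<^sub>F n in sequentially. \<forall>j\<in>{..N}. c < iter_log j (real n)"
    using filterlim_iter_log_nat by (intro eventually_ball_finite) (auto simp: filterlim_at_top_dense)
  then show ?thesis by (rule eventually_mono) simp
qed

lemma iter_log_over_id_tendsto_0: "1 \<le> k \<Longrightarrow> ((\<lambda>x. iter_log k x / x) \<longlongrightarrow> 0) at_top"
proof (induction k rule: dec_induct)
  case base
  then show ?case using ln_x_over_x_tendsto_0 by (simp add: iter_log_def)
next
  case (step k)
  have lim: "((\<lambda>x. ln (iter_log k x) / iter_log k x * (iter_log k x / x)) \<longlongrightarrow> 0) at_top"
    by (intro tendsto_mult_zero step.IH filterlim_compose[OF ln_x_over_x_tendsto_0 filterlim_iter_log])
  have "\<forall>\<^sub>F x in at_top. 0 < iter_log k x"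
    using filterlim_iter_log by (simp add: filterlim_at_top_dense)
  then have "\<forall>\<^sub>F x in at_top. ln (iter_log k x) / iter_log k x * (iter_log k x / x) = iter_log (Suc k) x / x"
    by eventually_elim (simp add: iter_log_Suc)
  then show ?case by (rule Lim_transform_eventually[OF lim])
qed

text \<open>For large \<open>x\<close> this is the derivative \<open>1 / (x log_1 x \<dots> log_{N-1} x)\<close> of \<open>log_N\<close>.\<close>

definition log_weight :: "nat \<Rightarrow> real \<Rightarrow> real" where
  "log_weight N x = exp (- (\<Sum>j=1..N. iter_log j x))"

lemma log_weight_pos: "0 < log_weight N x"
  by (simp add: log_weight_def)

lemma log_weight_0 [simp]: "log_weight 0 x = 1"
  by (simp add: log_weight_def)

lemma log_weight_Suc:
  assumes "0 < iter_log N x"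
  shows "log_weight (Suc N) x = log_weight N x / iter_log N x"
  using assms by (simp add: log_weight_def iter_log_Suc exp_diff)

text \<open>Discrete form of \<open>log_weight N\<close> being the derivative of
  \<open>iter_log N\<close>: at each level \<open>ln a - ln b \<le> (a - b) / b\<close> bounds the
  increment from above by the weight at the left end and, with \<open>a\<close> and \<open>b\<close>
  exchanged, from below by the weight at the right end.\<close>

lemma iter_log_increment:
  assumes "\<And>j. j \<le> N \<Longrightarrow> 0 < iter_log j x" "\<And>j. j \<le> N \<Longrightarrow> 0 < iter_log j (x + 1)"
  shows "iter_log N (x + 1) - iter_log N x \<le> log_weight N x"
    and "log_weight N (x + 1) \<le> iter_log N (x + 1) - iter_log N x"
proof -
  have "iter_log N (x + 1) - iter_log N x \<le> log_weight N x \<and>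
    log_weight N (x + 1) \<le> iter_log N (x + 1) - iter_log N x"
    using assms
  proof (induction N)
    case (Suc N)
    then have pos: "0 < iter_log N x" "0 < iter_log N (x + 1)" by auto
    have IH: "iter_log N (x + 1) - iter_log N x \<le> log_weight N x"
      "log_weight N (x + 1) \<le> iter_log N (x + 1) - iter_log N x" using Suc by auto
    have "iter_log (Suc N) (x + 1) - iter_log (Suc N) x \<le> log_weight N x / iter_log N x"
      unfolding iter_log_Suc
      by (rule order_trans[OF ln_diff_le]) (use pos IH in \<open>auto intro: divide_right_mono\<close>)
    moreover have "log_weight N (x + 1) / iter_log N (x + 1) \<le> (iter_log N (x + 1) - iter_log N x) / iter_log N (x + 1)"
      using pos IH by (intro divide_right_mono) auto
    then have "log_weight N (x + 1) / iter_log N (x + 1) \<le> iter_log (Suc N) (x + 1) - iter_log (Suc N) x"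
      using ln_diff_le[OF pos] by (simp add: iter_log_Suc diff_divide_distrib)
    ultimately show ?case using log_weight_Suc[OF pos(1)] log_weight_Suc[OF pos(2)] by simp
  qed simp
  then show "iter_log N (x + 1) - iter_log N x \<le> log_weight N x"
    "log_weight N (x + 1) \<le> iter_log N (x + 1) - iter_log N x" by auto
qed

lemma eventually_iter_log_increment:
  "\<forall>\<^sub>F n in sequentially. iter_log N (real (Suc n)) - iter_log N (real n) \<le> log_weight N (real n) \<and>
     log_weight N (real (Suc n)) \<le> iter_log N (real (Suc n)) - iter_log N (real n)"
proof -
  have "\<forall>\<^sub>F n in sequentially. \<forall>j\<le>N. 0 < iter_log j (real (Suc n))"
    using eventually_iter_log_pos[of N 0] by (subst eventually_sequentially_Suc)
  with eventually_iter_log_pos[of N 0] show ?thesis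
  proof eventually_elim
    case (elim n)
    then show ?case using iter_log_increment[of N "real n"] by (simp add: add.commute)
  qed
qed

text \<open>The partial sums dominate telescoping increments of \<open>iter_log N\<close>, which
  tends to infinity.\<close>

lemma not_summable_log_weight: "\<not> summable (\<lambda>n. log_weight N (real n))"
proof
  assume sm: "summable (\<lambda>n. log_weight N (real n))"
  obtain n0 where n0: "\<And>n. n \<ge> n0 \<Longrightarrow> iter_log N (real (Suc n)) - iter_log N (real n) \<le> log_weight N (real n)"
    using eventually_iter_log_increment[of N] by (auto simp: eventually_sequentially)
  have le: "iter_log N (real m) \<le> iter_log N (real n0) + suminf (\<lambda>n. log_weight N (real n))" if "n0 \<le> m" for m
  proof -
    have "iter_log N (real m) - iter_log N (real n0) = (\<Sum>n=n0..<m. iter_log N (real (Suc n)) - iter_log N (real n))"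
      using that by (rule sum_Suc_diff'[symmetric])
    also have "\<dots> \<le> (\<Sum>n=n0..<m. log_weight N (real n))" by (intro sum_mono n0) auto
    also have "\<dots> \<le> suminf (\<lambda>n. log_weight N (real n))"
      by (intro sum_le_suminf sm) (auto simp: less_imp_le log_weight_pos)
    finally show ?thesis by simp
  qed
  have "\<forall>\<^sub>F m in sequentially. iter_log N (real n0) + suminf (\<lambda>n. log_weight N (real n)) < iter_log N (real m)"
    using filterlim_iter_log_nat by (auto simp: filterlim_at_top_dense)
  then have "\<forall>\<^sub>F m in sequentially. False"
    using eventually_ge_at_top[of n0] by eventually_elim (use le in \<open>auto simp: not_less[symmetric]\<close>)
  then show False by simp
qed

text \<open>In the continuous analogue the summand is the derivative of \<open>- u\<close>. The
  discrete version compares the term at \<open>Suc n\<close> with \<open>u n - u (Suc n)\<close>,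
  because the increment of \<open>iter_log N\<close> bounds the weight at the right end.\<close>

lemma summable_log_weight_exp:
  assumes "0 < \<epsilon>"
  shows "summable (\<lambda>n. log_weight N (real n) * exp (- \<epsilon> * iter_log N (real n)))"
proof -
  define u where "u n = exp (- \<epsilon> * iter_log N (real n)) / \<epsilon>" for n
  have "filterlim (\<lambda>n. - \<epsilon> * iter_log N (real n)) at_bot sequentially"
    using filterlim_tendsto_neg_mult_at_bot[OF tendsto_const _ filterlim_iter_log_nat, of "- \<epsilon>" N] assms by simp
  then have "(\<lambda>n. exp (- \<epsilon> * iter_log N (real n))) \<longlonglongrightarrow> 0"
    by (rule filterlim_compose[OF exp_at_bot])
  then have "u \<longlonglongrightarrow> 0" unfolding u_def by (rule tendsto_divide_zero)
  then have sm: "summable (\<lambda>n. u n - u (Suc n))" by (rule telescope_summable')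
  have "\<forall>\<^sub>F n in sequentially.
    norm (log_weight N (real (Suc n)) * exp (- \<epsilon> * iter_log N (real (Suc n)))) \<le> u n - u (Suc n)"
    using eventually_iter_log_increment[of N]
  proof eventually_elim
    case (elim n)
    define d where "d = iter_log N (real (Suc n)) - iter_log N (real n)"
    have "log_weight N (real (Suc n)) * \<epsilon> \<le> \<epsilon> * d" using elim assms by (simp add: d_def)
    also have "\<dots> \<le> exp (\<epsilon> * d) - 1" using exp_ge_add_one_self[of "\<epsilon> * d"] by linarith
    finally have "log_weight N (real (Suc n)) \<le> (exp (\<epsilon> * d) - 1) / \<epsilon>"
      using assms by (simp add: pos_le_divide_eq)
    then have "log_weight N (real (Suc n)) * exp (- \<epsilon> * iter_log N (real (Suc n)))
        \<le> (exp (\<epsilon> * d) - 1) / \<epsilon> * exp (- \<epsilon> * iter_log N (real (Suc n)))"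
      by (rule mult_right_mono) simp
    also have "\<dots> = u n - u (Suc n)"
      unfolding u_def d_def
      by (simp add: diff_divide_distrib left_diff_distrib right_diff_distrib flip: exp_add)
    finally show ?case by (simp add: abs_mult log_weight_pos less_imp_le)
  qed
  then have "summable (\<lambda>n. log_weight N (real (Suc n)) * exp (- \<epsilon> * iter_log N (real (Suc n))))"
    by (rule summable_comparison_test_ev[OF _ sm])
  then show ?thesis by (subst (asm) summable_Suc_iff)
qed

text \<open>The factor \<open>1 / ln 2\<close> in \<open>run_f\<close> turns base 2 into the base of
  \<open>exp\<close>, and dividing by \<open>R\<close> supplies the term \<open>ln R\<close> that
  the sum over \<open>j \<ge> 2\<close> leaves out.\<close>

lemma two_powr_minus_run_f:
  assumes "1 \<le> N" "0 < R"
  shows "2 powr (- run_f N R \<epsilon>) / real R = log_weight N (real R) * exp (- \<epsilon> * iter_log N (real R))"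
proof -
  have s: "(\<Sum>j=1..N. iter_log j (real R)) = ln (real R) + (\<Sum>j=2..N. iter_log j (real R))"
    using assms by (simp add: sum.atLeast_Suc_atMost iter_log_def numeral_2_eq_2)
  have "2 powr (- run_f N R \<epsilon>) = exp (- ((\<Sum>j=2..N. iter_log j (real R)) + \<epsilon> * iter_log N (real R)))"
    by (simp add: powr_def run_f_def)
  then show ?thesis
    using assms unfolding log_weight_def s
    by (simp add: exp_add exp_diff exp_minus field_simps)
qed

lemma run_f_over_id_tendsto_0:
  assumes "1 \<le> N"
  shows "(\<lambda>R. run_f N R \<epsilon> / real R) \<longlonglongrightarrow> 0"
proof -
  have lim: "(\<lambda>R. iter_log j (real R) / real R) \<longlonglongrightarrow> 0" if "1 \<le> j" for j
    by (rule filterlim_compose[OF iter_log_over_id_tendsto_0[OF that] filterlim_real_sequentially])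
  have "(\<lambda>R. 1 / ln 2 * ((\<Sum>j=2..N. iter_log j (real R) / real R) + \<epsilon> * (iter_log N (real R) / real R)))
      \<longlonglongrightarrow> 1 / ln 2 * ((\<Sum>j=2..N. 0) + \<epsilon> * 0)"
    using assms by (intro tendsto_intros lim) auto
  then show ?thesis by (simp add: run_f_def add_divide_distrib sum_divide_distrib mult.commute)
qed

text \<open>Guarantees that truncation by \<open>nat\<close> loses nothing and that the
  \<open>Suc L\<close> sites of a run starting at \<open>R\<close> satisfy
  \<open>Suc L \<le> R\<close>.\<close>

lemma eventually_run_f_bounds:
  assumes "1 \<le> N" "0 \<le> \<epsilon>"
  shows "\<forall>\<^sub>F R in sequentially. 0 \<le> run_f N R \<epsilon> \<and> run_f N R \<epsilon> + 1 \<le> real R"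
proof -
  have "\<forall>\<^sub>F R in sequentially. run_f N R \<epsilon> / real R < 1 / 2"
    using order_tendstoD(2)[OF run_f_over_id_tendsto_0[OF assms(1)], of "1/2"] by simp
  then show ?thesis
    using eventually_iter_log_pos[of N 0] eventually_ge_at_top[of 2]
  proof eventually_elim
    case (elim R)
    have "0 \<le> (\<Sum>j=2..N. iter_log j (real R)) + \<epsilon> * iter_log N (real R)"
      using elim assms by (intro add_nonneg_nonneg sum_nonneg mult_nonneg_nonneg) (auto intro: less_imp_le)
    then have "0 \<le> run_f N R \<epsilon>" by (simp add: run_f_def)
    moreover have "2 \<le> real R" using elim by simp
    moreover from this have "run_f N R \<epsilon> < real R / 2" using elim(1) by (simp add: pos_divide_less_eq)
    ultimately show ?case by linarith
  qed
qed

text \<open>Two terms of the exponent are kept. The extra \<open>1 / ln R\<close> later offsets the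
  logarithm that arises from summing over a window of sites.\<close>

lemma eventually_log_weight_le:
  assumes "2 \<le> N"
  shows "\<forall>\<^sub>F R in sequentially. log_weight N (real R) \<le> 1 / (real R * ln (real R))"
  using eventually_iter_log_pos[of N 0]
proof eventually_elim
  case (elim R)
  have "(\<Sum>j\<in>{1,2}. iter_log j (real R)) \<le> (\<Sum>j=1..N. iter_log j (real R))"
    using elim assms by (intro sum_mono2) (auto intro: less_imp_le)
  moreover have "0 < real R" "0 < ln (real R)"
    using elim[rule_format, of 0] elim[rule_format, of 1] assms by (auto simp: iter_log_def)
  ultimately have "log_weight N (real R) \<le> exp (- (ln (real R) + ln (ln (real R))))"
    by (simp add: log_weight_def iter_log_def numeral_2_eq_2)
  also have "\<dots> = 1 / (real R * ln (real R))"
    using \<open>0 < real R\<close> \<open>0 < ln (real R)\<close> by (simp add: exp_add exp_minus exp_diff divide_simps)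
  finally show ?case .
qed

section \<open>Harmonic sums and rounding\<close>

lemma sum_inverse_le_ln:
  assumes "1 \<le> m"
  shows "(\<Sum>k=1..m. 1 / real k) \<le> 1 + ln (real m)"
  using assms
proof (induction m rule: dec_induct)
  case (step m)
  have "ln (real m) - ln (real (Suc m)) \<le> - (1 / real (Suc m))"
    using step ln_diff_le[of "real m" "real (Suc m)"] by (simp add: field_simps)
  then show ?case using step by simp
qed simp

lemma sum_window_inverse_le:
  fixes R n :: nat and K :: real
  assumes "1 \<le> K"
  shows "(\<Sum>S\<in>{S. S < n \<and> R < S \<and> real S < K}. 1 / (real S - real R)) \<le> 1 + ln K"
proof -
  define m where "m = nat \<lfloor>K\<rfloor>"
  have m: "1 \<le> m" "real m \<le> K" using assms by (auto simp: m_def le_nat_iff)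
  have "(\<Sum>S\<in>{S. S < n \<and> R < S \<and> real S < K}. 1 / (real S - real R)) \<le> (\<Sum>S\<in>(\<lambda>k. R + k) ` {1..m}. 1 / (real S - real R))"
  proof (rule sum_mono2)
    show "{S. S < n \<and> R < S \<and> real S < K} \<subseteq> (\<lambda>k. R + k) ` {1..m}"
    proof
      fix S assume "S \<in> {S. S < n \<and> R < S \<and> real S < K}"
      then have "S - R \<in> {1..m}" "S = R + (S - R)"
        by (auto simp: m_def le_nat_iff le_floor_iff)
      then show "S \<in> (\<lambda>k. R + k) ` {1..m}" by blast
    qed
  qed auto
  also have "\<dots> = (\<Sum>k=1..m. 1 / real k)" by (subst sum.reindex) auto
  also have "\<dots> \<le> 1 + ln (real m)" by (rule sum_inverse_le_ln[OF m(1)])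
  also have "\<dots> \<le> 1 + ln K" using m by simp
  finally show ?thesis .
qed

text \<open>Rounding a length down costs at most a factor 2. The exponent carries \<open>Suc\<close>
  because the run \<open>R, ..., R + L\<close> has \<open>L + 1\<close> sites.\<close>

lemma half_power_floor:
  fixes f :: real
  assumes "0 \<le> f"
  shows "(1 / 2) ^ Suc (nat \<lfloor>f\<rfloor>) \<le> 2 powr (- f)" "2 powr (- f) / 2 \<le> (1 / 2) ^ Suc (nat \<lfloor>f\<rfloor>)"
proof -
  define L where "L = nat \<lfloor>f\<rfloor>"
  have L: "real L \<le> f" "f \<le> real (Suc L)" using assms by (auto simp: L_def) linarith
  have eq: "(1 / 2) ^ Suc L = 2 powr (- real (Suc L))"
    by (simp add: powr_minus powr_realpow power_one_over inverse_eq_divide del: of_nat_Suc power_Suc)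
  have "2 powr (- real (Suc L)) \<le> 2 powr (- f)" using L by (intro powr_mono) auto
  then show "(1 / 2) ^ Suc (nat \<lfloor>f\<rfloor>) \<le> 2 powr (- f)" by (simp only: eq flip: L_def)
  have "2 powr (- f) / 2 = 2 powr (- f - 1)" by (simp add: powr_diff)
  also have "\<dots> \<le> 2 powr (- real (Suc L))" using L by (intro powr_mono) auto
  finally show "2 powr (- f) / 2 \<le> (1 / 2) ^ Suc (nat \<lfloor>f\<rfloor>)" by (simp only: eq flip: L_def)
qed

section \<open>Histories of the walk\<close>

context nn_walk begin

text \<open>Newest position first: \<open>hd\<close> is the current site, a step is a
  \<open>Cons\<close>, and the maximum of the \<open>set\<close> is the running maximum.\<close>

primrec hist :: "nat \<Rightarrow> 'a \<Rightarrow> nat list" where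
  "hist 0 \<omega> = [X 0 \<omega>]"
| "hist (Suc n) \<omega> = X (Suc n) \<omega> # hist n \<omega>"

lemma length_hist [simp]: "length (hist n \<omega>) = Suc n"
  by (induction n) auto

lemma hist_neq_Nil [simp]: "hist n \<omega> \<noteq> []"
  by (cases n) auto

lemma hd_hist [simp]: "hd (hist n \<omega>) = X n \<omega>"
  by (cases n) auto

lemma nth_hist: "i \<le> n \<Longrightarrow> hist n \<omega> ! i = X (n - i) \<omega>"
proof (induction n arbitrary: i)
  case (Suc n)
  then show ?case by (cases i) auto
qed auto

lemma set_hist: "set (hist n \<omega>) = (\<lambda>k. X k \<omega>) ` {..n}"
  by (induction n) (auto simp: atMost_Suc)

lemma hist_eq_iff:
  "hist n \<omega> = h \<longleftrightarrow> length h = Suc n \<and> (\<forall>k\<le>n. X k \<omega> = h ! (n - k))"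
proof -
  have "(\<forall>i\<le>n. X (n - i) \<omega> = h ! i) \<longleftrightarrow> (\<forall>k\<le>n. X k \<omega> = h ! (n - k))"
    by (metis diff_diff_cancel diff_le_self)
  then show ?thesis
    by (auto simp: list_eq_iff_nth_eq nth_hist less_Suc_eq_le)
qed

lemma measurable_hist [measurable]: "hist n \<in> measurable M (count_space UNIV)"
proof -
  have "hist n -` {h} \<inter> space M \<in> sets M" for h
  proof -
    have "hist n -` {h} \<inter> space M = {\<omega>\<in>space M. length h = Suc n \<and> (\<forall>k\<le>n. X k \<omega> = h ! (n - k))}"
      unfolding hist_eq_iff[symmetric] by auto
    also have "\<dots> \<in> sets M" by measurable
    finally show ?thesis .
  qed
  then show ?thesis
    by (subst measurable_count_space_eq2_countable) auto
qed

text \<open>The Markov property as an identity of joint probabilities; for a null history both sides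
  vanish.\<close>

lemma prob_hist_step:
  "prob {\<omega>\<in>space M. hist n \<omega> = h \<and> X (Suc n) \<omega> = j}
     = prob {\<omega>\<in>space M. hist n \<omega> = h} * step_prob p (hd h) j"
proof (cases "length h = Suc n \<and> prob {\<omega>\<in>space M. hist n \<omega> = h} > 0")
  case False
  then have z: "prob {\<omega>\<in>space M. hist n \<omega> = h} = 0"
    by (smt (verit) Collect_empty_eq length_hist measure_empty measure_nonneg)
  have "prob {\<omega>\<in>space M. hist n \<omega> = h \<and> X (Suc n) \<omega> = j} \<le> prob {\<omega>\<in>space M. hist n \<omega> = h}"
    by (intro finite_measure_mono) auto
  with z show ?thesis by (simp add: measure_le_0_iff)
next
  case True
  define x where "x k = (if k \<le> n then h ! (n - k) else j)" for k
  have eq: "hist n \<omega> = h \<longleftrightarrow> (\<forall>k\<le>n. X k \<omega> = x k)" for \<omega>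
    using True by (auto simp: hist_eq_iff x_def)
  have "x n = hd h" using True by (cases h) (auto simp: x_def)
  moreover have "x (Suc n) = j" by (simp add: x_def)
  ultimately show ?thesis
    using markov[of n x] True by (simp add: eq cond_prob_def field_simps conj_commute)
qed

text \<open>Each forbidden triple of time, history and next site is a null event, and there are
  countably many of them.\<close>

lemma AE_nearest_neighbour:
  "AE \<omega> in M. \<forall>n. X (Suc n) \<omega> = Suc (X n \<omega>) \<or> Suc (X (Suc n) \<omega>) = X n \<omega>"
proof -
  have "AE \<omega> in M. \<not> (hist n \<omega> = h \<and> X (Suc n) \<omega> = j)"
    if "j \<noteq> Suc (hd h)" "Suc j \<noteq> hd h" for n h j
    using that prob_hist_step[of n h j]
    by (subst AE_iff_measurable[OF _ refl]) (auto simp: step_prob_def emeasure_eq_measure)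
  then have "AE \<omega> in M. \<forall>n h j. j \<noteq> Suc (hd h) \<and> Suc j \<noteq> hd h \<longrightarrow> \<not> (hist n \<omega> = h \<and> X (Suc n) \<omega> = j)"
    by (auto simp only: AE_all_countable intro!: AE_impI)
  then show ?thesis by eventually_elim (metis hd_hist)
qed

lemma AE_X_le: "AE \<omega> in M. \<forall>n. X n \<omega> \<le> n"
  using start AE_nearest_neighbour
proof eventually_elim
  fix \<omega> assume *: "X 0 \<omega> = 0" "\<forall>n. X (Suc n) \<omega> = Suc (X n \<omega>) \<or> Suc (X (Suc n) \<omega>) = X n \<omega>"
  show "\<forall>n. X n \<omega> \<le> n"
  proof
    fix n show "X n \<omega> \<le> n"
    proof (induction n)
      case (Suc n)
      then show ?case using *(2)[rule_format, of n] by linarith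
    qed (use * in simp)
  qed
qed

text \<open>Up to time \<open>n\<close> the walk almost surely stays in \<open>{..n}\<close>, so
  finitely many histories carry all the mass and both expectations are finite sums for arbitrary
  \<open>\<phi>\<close>.\<close>

lemma expectation_hist_Suc:
  fixes \<phi> :: "nat list \<Rightarrow> real"
  shows "expectation (\<lambda>\<omega>. \<phi> (hist (Suc n) \<omega>)) =
    expectation (\<lambda>\<omega>. up_prob p (X n \<omega>) * \<phi> (Suc (X n \<omega>) # hist n \<omega>)
      + (1 - up_prob p (X n \<omega>)) * \<phi> ((X n \<omega> - 1) # hist n \<omega>))"
    (is "?L = ?R")
proof -
  define F where "F = {h. set h \<subseteq> {..n} \<and> length h = Suc n}"
  have fin [simp]: "finite F" unfolding F_def by (intro finite_lists_length_eq) auto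
  have F: "AE \<omega> in M. hist n \<omega> \<in> F"
    using AE_X_le by eventually_elim (auto simp: F_def set_hist intro: order_trans)
  define \<psi> where "\<psi> h = up_prob p (hd h) * \<phi> (Suc (hd h) # h) + (1 - up_prob p (hd h)) * \<phi> ((hd h - 1) # h)" for h
  \<comment> \<open>At the origin truncated subtraction makes \<open>hd h - 1\<close> equal to
    \<open>0\<close>, which is no step down. Here that term is set to \<open>0\<close>; in
    \<open>\<psi>\<close> the factor \<open>1 - up_prob p 0 = 0\<close> removes it.\<close>
  define \<theta> where "\<theta> h = (if hd h = 0 then 0 else \<phi> ((hd h - 1) # h))" for h
  define H where "H h = {\<omega>\<in>space M. hist n \<omega> = h}" for h
  define J where "J h j = {\<omega>\<in>space M. hist n \<omega> = h \<and> X (Suc n) \<omega> = j}" for h j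
  have [measurable]: "H h \<in> sets M" "J h j \<in> sets M" for h j
    unfolding H_def J_def by measurable
  have "?R = expectation (\<lambda>\<omega>. \<psi> (hist n \<omega>))" by (simp add: \<psi>_def)
  also have "\<dots> = expectation (\<lambda>\<omega>. \<Sum>h\<in>F. \<psi> h * indicator (H h) \<omega>)"
  proof (intro integral_cong_AE)
    show "AE \<omega> in M. \<psi> (hist n \<omega>) = (\<Sum>h\<in>F. \<psi> h * indicator (H h) \<omega>)"
      using F AE_space
    proof eventually_elim
      case (elim \<omega>)
      have "(\<Sum>h\<in>F. \<psi> h * indicator (H h) \<omega>) = (\<Sum>h\<in>F. if hist n \<omega> = h then \<psi> h else 0)"
        using elim by (intro sum.cong) (auto simp: H_def)
      then show ?case using elim by simp
    qed
  qed measurable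
  also have "\<dots> = (\<Sum>h\<in>F. \<psi> h * prob (H h))"
    by (subst Bochner_Integration.integral_sum) (auto intro!: integrable_mult_right simp: less_top[symmetric])
  finally have R: "?R = (\<Sum>h\<in>F. \<psi> h * prob (H h))" .
  have "?L = expectation (\<lambda>\<omega>. \<Sum>h\<in>F. \<phi> (Suc (hd h) # h) * indicator (J h (Suc (hd h))) \<omega>
       + \<theta> h * indicator (J h (hd h - 1)) \<omega>)"
  proof (intro integral_cong_AE)
    show "AE \<omega> in M. \<phi> (hist (Suc n) \<omega>) = (\<Sum>h\<in>F. \<phi> (Suc (hd h) # h) * indicator (J h (Suc (hd h))) \<omega>
       + \<theta> h * indicator (J h (hd h - 1)) \<omega>)"
      using F AE_space AE_nearest_neighbour
    proof eventually_elim
      case (elim \<omega>)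
      have nn: "X (Suc n) \<omega> = Suc (X n \<omega>) \<or> X n \<omega> = Suc (X (Suc n) \<omega>)"
        using elim(3) by metis
      have "(\<Sum>h\<in>F. \<phi> (Suc (hd h) # h) * indicator (J h (Suc (hd h))) \<omega>
         + \<theta> h * indicator (J h (hd h - 1)) \<omega>)
         = (\<Sum>h\<in>F. if hist n \<omega> = h then \<phi> (X (Suc n) \<omega> # h) else 0)"
        using elim(2) nn by (intro sum.cong) (auto simp: J_def \<theta>_def)
      then show ?case using elim by simp
    qed
  qed measurable
  also have "\<dots> = (\<Sum>h\<in>F. \<phi> (Suc (hd h) # h) * prob (J h (Suc (hd h)))
       + \<theta> h * prob (J h (hd h - 1)))"
    by (subst Bochner_Integration.integral_sum)
       (auto intro!: integrable_mult_right sum.cong Bochner_Integration.integrable_add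
             simp: less_top[symmetric])
  also have "\<dots> = (\<Sum>h\<in>F. \<psi> h * prob (H h))"
  proof (intro sum.cong refl)
    fix h
    have J: "prob (J h j) = prob (H h) * step_prob p (hd h) j" for j
      unfolding J_def H_def by (rule prob_hist_step)
    show "\<phi> (Suc (hd h) # h) * prob (J h (Suc (hd h)))
       + \<theta> h * prob (J h (hd h - 1)) = \<psi> h * prob (H h)"
      unfolding J by (cases "hd h") (auto simp: step_prob_def \<psi>_def \<theta>_def up_prob_def algebra_simps)
  qed
  finally show ?thesis using R by simp
qed

end

section \<open>Transience\<close>

definition odds :: "(nat \<Rightarrow> real) \<Rightarrow> nat \<Rightarrow> real" where
  "odds p i = (1 - up_prob p i) / up_prob p i"

definition weight :: "(nat \<Rightarrow> real) \<Rightarrow> nat \<Rightarrow> real" where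
  "weight p k = (\<Prod>i=1..k. odds p i)"

text \<open>Up to sign and an additive constant the scale function of the walk: ratios of its
  differences are exit probabilities from intervals.\<close>

definition weight_tail :: "(nat \<Rightarrow> real) \<Rightarrow> nat \<Rightarrow> real" where
  "weight_tail p n = (\<Sum>k. weight p (k + n))"

lemma weight_Suc: "weight p (Suc k) = weight p k * odds p (Suc k)"
  by (simp add: weight_def)

locale transient_walk = nn_walk +
  assumes p_nonneg: "1 \<le> i \<Longrightarrow> 0 \<le> p i"
    and p_less: "1 \<le> i \<Longrightarrow> p i < 1 / 2"
    and summable_weight: "summable (weight p)"
begin

abbreviation "E \<equiv> up_prob p"
abbreviation "r \<equiv> weight p"
abbreviation "T \<equiv> weight_tail p"

lemma E_ge_half: "1 / 2 \<le> E i" and E_pos: "0 < E i"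
  using p_nonneg[of i] p_less[of i] by (auto simp: up_prob_def)

lemma E_Suc_less_1: "E (Suc i) < 1"
  using p_less[of "Suc i"] by (auto simp: up_prob_def)

lemma r_pos: "0 < r k"
  unfolding weight_def odds_def
  by (intro prod_pos) (use E_pos E_Suc_less_1 in \<open>auto simp: gr0_conv_Suc Suc_le_eq intro!: divide_pos_pos\<close>)

lemma balance: "E (Suc x) * r (Suc x) = (1 - E (Suc x)) * r x"
  using E_pos[of "Suc x"] by (simp add: weight_Suc odds_def)

lemma T_Suc: "T n = r n + T (Suc n)"
  unfolding weight_tail_def
  using suminf_split_head[OF summable_ignore_initial_segment[OF summable_weight, of n]] by simp

lemma T_pos: "0 < T n"
  unfolding weight_tail_def
  by (intro suminf_pos summable_ignore_initial_segment summable_weight) (simp add: r_pos)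

lemma T_Suc_less: "T (Suc n) < T n"
  using T_Suc[of n] r_pos[of n] by simp

lemma T_less: "m < n \<Longrightarrow> T n < T m"
  using lift_Suc_mono_less[of "\<lambda>n. - T n" m n] T_Suc_less by simp

lemma T_le: "m \<le> n \<Longrightarrow> T n \<le> T m"
  using T_less[of m n] by (cases "m = n") auto

lemma T_tendsto_0: "T \<longlonglongrightarrow> 0"
  unfolding weight_tail_def by (rule suminf_exist_split2[OF summable_weight])

lemma T_harmonic: "E (Suc x) * T (Suc (Suc x)) + (1 - E (Suc x)) * T x = T (Suc x)"
  using balance[of x] T_Suc[of x] T_Suc[of "Suc x"] by (simp add: algebra_simps)

text \<open>The function \<open>y \<mapsto> T (max x y)\<close> is superharmonic, with defect \<open>E x * r x\<close> at
  \<open>x\<close> and none elsewhere. Hence the expected number of visits to \<open>x\<close> is finite.\<close>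

lemma sum_prob_visit_le: "(\<Sum>n<m. prob {\<omega>\<in>space M. X n \<omega> = x}) * (E x * r x) \<le> T x"
proof -
  define V where "V n = {\<omega>\<in>space M. X n \<omega> = x}" for n
  have [measurable]: "V n \<in> sets M" for n unfolding V_def by measurable
  define G where "G y = T (max x y)" for y
  have G_bounds: "0 \<le> G y" "G y \<le> T x" for y
    using T_pos[of "max x y"] T_le[of x "max x y"] by (auto simp: G_def)
  have int_G: "integrable M (\<lambda>\<omega>. G (X n \<omega>))" for n
    by (intro integrable_const_bound[where B = "T x"]) (auto simp: G_bounds)
  have super: "E y * G (Suc y) + (1 - E y) * G (y - 1) = G y - (E x * r x) * of_bool (y = x)" for y
  proof (cases y x rule: linorder_cases)
    case less
    then have "max x (Suc y) = x" "max x (y - 1) = x" "max x y = x" by auto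
    with less show ?thesis by (simp add: G_def algebra_simps)
  next
    case equal
    then have "max x (Suc y) = Suc x" "max x (y - 1) = x" by auto
    with equal show ?thesis using T_Suc[of x] by (simp add: G_def algebra_simps)
  next
    case greater
    then obtain z where "y = Suc z" "x \<le> z" by (cases y) auto
    then show ?thesis using T_harmonic[of z] by (simp add: G_def max_def)
  qed
  have step: "expectation (\<lambda>\<omega>. G (X (Suc n) \<omega>)) = expectation (\<lambda>\<omega>. G (X n \<omega>)) - (E x * r x) * prob (V n)" for n
  proof -
    have "expectation (\<lambda>\<omega>. G (X (Suc n) \<omega>))
        = expectation (\<lambda>\<omega>. G (X n \<omega>) - (E x * r x) * of_bool (X n \<omega> = x))"
      using expectation_hist_Suc[of "\<lambda>h. G (hd h)" n] by (simp add: super[unfolded One_nat_def])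
    also have "\<dots> = expectation (\<lambda>\<omega>. G (X n \<omega>) - (E x * r x) * indicator (V n) \<omega>)"
      by (intro Bochner_Integration.integral_cong) (auto simp: V_def)
    also have "\<dots> = expectation (\<lambda>\<omega>. G (X n \<omega>)) - (E x * r x) * prob (V n)"
      by (subst Bochner_Integration.integral_diff) (auto intro!: int_G simp: less_top[symmetric])
    finally show ?thesis .
  qed
  \<comment> \<open>Each visit to \<open>x\<close> uses up \<open>E x * r x\<close> of the
    expectation of \<open>G\<close>, which starts at most at \<open>T x\<close> and never becomes
    negative.\<close>
  have "(\<Sum>n<m. prob (V n)) * (E x * r x) = expectation (\<lambda>\<omega>. G (X 0 \<omega>)) - expectation (\<lambda>\<omega>. G (X m \<omega>))"
    by (induction m) (auto simp: step algebra_simps)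
  also have "\<dots> \<le> expectation (\<lambda>\<omega>. G (X 0 \<omega>))"
    by (simp add: G_bounds)
  also have "\<dots> \<le> T x"
    using integral_mono[OF int_G, of "\<lambda>_. T x" 0] G_bounds by (simp add: prob_space)
  finally show ?thesis by (simp add: V_def)
qed

text \<open>The expected number of visits to a site is finite, so the first Borel-Cantelli lemma
  applies to each of the countably many sites.\<close>

lemma AE_finite_visits: "AE \<omega> in M. \<forall>x. finite {n. X n \<omega> = x}"
  unfolding AE_all_countable
proof
  fix x
  define V where "V n = {\<omega>\<in>space M. X n \<omega> = x}" for n
  have c: "0 < E x * r x" using E_pos r_pos by simp
  have "(\<Sum>n<m. prob (V n)) \<le> T x / (E x * r x)" for m
    using sum_prob_visit_le[where m = m and x = x] c by (simp add: V_def pos_le_divide_eq)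
  then have "summable (\<lambda>n. prob (V n))"
    by (intro bounded_imp_summable[where B = "T x / (E x * r x)"])
       (auto simp flip: lessThan_Suc_atMost simp del: sum.lessThan_Suc)
  then have "AE \<omega> in M. eventually (\<lambda>n. \<omega> \<in> space M - V n) sequentially"
    by (intro borel_cantelli_AE1) (auto simp: V_def less_top[symmetric])
  then show "AE \<omega> in M. finite {n. X n \<omega> = x}"
    using AE_space
  proof eventually_elim
    case (elim \<omega>)
    then obtain N where "\<And>n. n \<ge> N \<Longrightarrow> X n \<omega> \<noteq> x"
      by (auto simp: eventually_sequentially V_def)
    then have "{n. X n \<omega> = x} \<subseteq> {..<N}" by (auto simp: not_less[symmetric])
    then show ?case by (rule finite_subset) simp
  qed
qed

lemma AE_tends_to_infinity: "AE \<omega> in M. \<forall>x. \<forall>\<^sub>F n in sequentially. x < X n \<omega>"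
  using AE_finite_visits
proof eventually_elim
  case (elim \<omega>)
  show ?case
  proof
    fix x
    have "finite (\<Union>y\<le>x. {n. X n \<omega> = y})" using elim by auto
    also have "(\<Union>y\<le>x. {n. X n \<omega> = y}) = {n. \<not> x < X n \<omega>}" by auto
    finally show "\<forall>\<^sub>F n in sequentially. x < X n \<omega>"
      by (simp add: eventually_cofinite flip: cofinite_eq_sequentially)
  qed
qed

end

section \<open>Staying above a barrier\<close>

text \<open>The barrier can move only when the walk sets a new maximum. Between two records it is
  constant, so survival there is an exit problem for an interval.\<close>

definition above_barrier :: "(nat \<Rightarrow> nat) \<Rightarrow> (nat \<Rightarrow> nat) \<Rightarrow> bool" where
  "above_barrier b x \<longleftrightarrow> (\<forall>n. b (Max (x ` {..n})) \<le> x n)"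

fun hist_above :: "(nat \<Rightarrow> nat) \<Rightarrow> nat list \<Rightarrow> bool" where
  "hist_above b [] \<longleftrightarrow> True"
| "hist_above b (x # h) \<longleftrightarrow> b (Max (set (x # h))) \<le> x \<and> hist_above b h"

context transient_walk begin

lemma hist_above_hist:
  "hist_above b (hist n \<omega>) \<longleftrightarrow> (\<forall>k\<le>n. b (Max ((\<lambda>k. X k \<omega>) ` {..k})) \<le> X k \<omega>)"
proof (induction n)
  case (Suc n)
  have "set (hist (Suc n) \<omega>) = (\<lambda>k. X k \<omega>) ` {..Suc n}" by (rule set_hist)
  then show ?case using Suc by (auto simp: le_Suc_eq simp del: list.set)
qed auto

lemma above_barrier_iff: "above_barrier b (\<lambda>k. X k \<omega>) \<longleftrightarrow> (\<forall>n. hist_above b (hist n \<omega>))"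
  by (auto simp: above_barrier_def hist_above_hist)

lemma above_barrier_measurable [measurable]:
  "Measurable.pred M (\<lambda>\<omega>. above_barrier b (\<lambda>k. X k \<omega>))"
  unfolding above_barrier_iff by measurable

text \<open>Probability to reach \<open>Suc y\<close> before falling below \<open>b y\<close>, for a start in \<open>x\<close>;
  the value \<open>b y = 0\<close> imposes nothing.\<close>

definition pass_prob :: "(nat \<Rightarrow> nat) \<Rightarrow> nat \<Rightarrow> nat \<Rightarrow> real" where
  "pass_prob b y x = (if b y = 0 then 1 else (T (b y - 1) - T x) / (T (b y - 1) - T (Suc y)))"

text \<open>For \<open>b y > 0\<close> this is an affine function of \<open>T\<close>, which is
  harmonic off \<open>0\<close>, and \<open>b y \<le> x\<close> keeps \<open>x\<close> off
  \<open>0\<close>; for \<open>b y = 0\<close> it is constant.\<close>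

lemma pass_prob_harmonic:
  assumes "b y \<le> x"
  shows "E x * pass_prob b y (Suc x) + (1 - E x) * pass_prob b y (x - 1) = pass_prob b y x"
proof (cases "b y = 0")
  case False
  with assms obtain z where x: "x = Suc z" by (cases x) auto
  define c where "c = T (b y - 1)"
  define d where "d = c - T (Suc y)"
  have "E x * ((c - T (Suc x)) / d) + (1 - E x) * ((c - T (x - 1)) / d)
      = (c - (E x * T (Suc x) + (1 - E x) * T (x - 1))) / d"
    by (simp add: algebra_simps add_divide_distrib diff_divide_distrib)
  also have "\<dots> = (c - T x) / d" using T_harmonic[of z] by (simp add: x)
  finally show ?thesis using False by (simp add: pass_prob_def c_def d_def)
qed (simp add: pass_prob_def)

lemma pass_prob_bounds:
  assumes "b y \<le> y" "b y \<le> x" "x \<le> Suc y"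
  shows "0 \<le> pass_prob b y x" "pass_prob b y x \<le> 1"
proof -
  have "T x \<le> T (b y - 1)" "T (Suc y) \<le> T x" "T (Suc y) < T (b y - 1)"
    using assms by (auto intro!: T_le T_less)
  then show "0 \<le> pass_prob b y x" "pass_prob b y x \<le> 1"
    by (auto simp: pass_prob_def)
qed

lemma pass_prob_top: "b y \<le> y \<Longrightarrow> pass_prob b y (Suc y) = 1"
  using T_less[of "b y - 1" "Suc y"] by (simp add: pass_prob_def less_Suc_eq_le le_diff_conv)

lemma pass_prob_bottom: "Suc x = b y \<Longrightarrow> pass_prob b y x = 0"
  unfolding pass_prob_def by (metis diff_Suc_1 diff_self div_0 nat.distinct(1))

text \<open>The process \<open>\<Phi> (hist n \<omega>)\<close> is a martingale with values between
  0 and 1 that starts at the product. It tends almost surely to the indicator of success, since the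
  walk finally exceeds \<open>v\<close> and then faces no barrier.\<close>

lemma prob_above_barrier_finite:
  assumes b_le: "\<And>z. b z \<le> z" and b_0: "\<And>z. v \<le> z \<Longrightarrow> b z = 0"
  shows "prob {\<omega>\<in>space M. above_barrier b (\<lambda>k. X k \<omega>)} = (\<Prod>z<v. pass_prob b z z)"
proof -
  \<comment> \<open>The levels strictly above the current maximum \<open>y\<close>, each to be
    passed from its own first visit. Level \<open>y\<close> itself enters \<open>\<Phi>\<close>
    separately, from the current position.\<close>
  define Q where "Q y = (\<Prod>z\<in>{y<..<v}. pass_prob b z z)" for y
  (* The conditional probability of success given the history, hence a martingale. *)
  define \<Phi> where "\<Phi> h = (if hist_above b h then pass_prob b (Max (set h)) (hd h) * Q (Max (set h)) else 0)" for h
  define A where "A = {\<omega>\<in>space M. above_barrier b (\<lambda>k. X k \<omega>)}"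
  have [measurable]: "A \<in> sets M" unfolding A_def by measurable
  have Q_bounds: "0 \<le> Q y" "Q y \<le> 1" for y
    unfolding Q_def using b_le pass_prob_bounds by (auto intro!: prod_nonneg prod_le_1)
  have Q_step: "pass_prob b (Suc y) (Suc y) * Q (Suc y) = Q y" for y
  proof (cases "Suc y < v")
    case True
    then have "{y<..<v} = insert (Suc y) {Suc y<..<v}" by auto
    then show ?thesis by (simp add: Q_def)
  next
    case False
    then have "{y<..<v} = {}" "{Suc y<..<v} = {}" by auto
    then show ?thesis using b_0[of "Suc y"] False by (simp add: Q_def pass_prob_def)
  qed
  have hist_hd: "hist_above b h \<Longrightarrow> h \<noteq> [] \<Longrightarrow> b (Max (set h)) \<le> hd h" for h
    by (cases h) auto
  have hd_le: "h \<noteq> [] \<Longrightarrow> hd h \<le> Max (set h)" for h :: "nat list"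
    by simp
  have \<Phi>_bounds: "0 \<le> \<Phi> h" "\<Phi> h \<le> 1" if "h \<noteq> []" for h
    using that Q_bounds[of "Max (set h)"] pass_prob_bounds[of b "Max (set h)" "hd h"]
      hist_hd[of h] le_SucI[OF hd_le[OF that]] b_le
    by (auto simp: \<Phi>_def intro!: mult_le_one)
  have child: "\<Phi> (x # h) = pass_prob b (Max (set h)) x * Q (Max (set h))"
    if "hist_above b h" "h \<noteq> []" "x = Suc (hd h) \<or> x = hd h - 1" for x h
  proof -
    define y where "y = Max (set h)"
    have y: "hd h \<le> y" "b y \<le> hd h" using hd_le[of h] hist_hd[of h] that by (auto simp: y_def)
    have M: "Max (set (x # h)) = max x y" using that by (simp add: y_def)
    show ?thesis
    proof (cases "x = Suc y")
      \<comment> \<open>A new record completes level \<open>y\<close>, where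
        \<open>pass_prob\<close> has reached 1, and \<open>Q_step\<close> splits off the factor of
        the next level.\<close>
      case True
      have "hist_above b (x # h)" using that M b_le[of x] True by simp
      then show ?thesis using M Q_step[of y] pass_prob_top[of b y] b_le[of y] True
        by (simp add: \<Phi>_def flip: y_def)
    next
      case False
      then have m: "Max (set (x # h)) = y" using M that(3) y by auto
      show ?thesis
      proof (cases "b y \<le> x")
        case True
        then show ?thesis using that m by (simp add: \<Phi>_def flip: y_def)
      next
        case False
        \<comment> \<open>A single step can undercut the barrier only by one, and there
          \<open>pass_prob\<close> vanishes; hence \<open>T (b y - 1)\<close> in its
          definition.\<close>
        then have "Suc x = b y" using that(3) y by auto
        then show ?thesis using that m pass_prob_bottom[of x b y] by (simp add: \<Phi>_def flip: y_def)
      qed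
    qed
  qed
  have harmonic: "E (hd h) * \<Phi> (Suc (hd h) # h) + (1 - E (hd h)) * \<Phi> ((hd h - 1) # h) = \<Phi> h"
    if "h \<noteq> []" for h
  proof (cases "hist_above b h")
    case True
    let ?y = "Max (set h)"
    have "E (hd h) * \<Phi> (Suc (hd h) # h) + (1 - E (hd h)) * \<Phi> ((hd h - 1) # h)
      = (E (hd h) * pass_prob b ?y (Suc (hd h)) + (1 - E (hd h)) * pass_prob b ?y (hd h - 1)) * Q ?y"
      using child[OF True that] by (simp add: algebra_simps)
    then show ?thesis
      using pass_prob_harmonic[of b ?y "hd h", OF hist_hd[OF True that]] True by (simp add: \<Phi>_def)
  qed (simp add: \<Phi>_def)
  have const: "expectation (\<lambda>\<omega>. \<Phi> (hist n \<omega>)) = expectation (\<lambda>\<omega>. \<Phi> (hist 0 \<omega>))" for n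
  proof (induction n)
    case (Suc n)
    have "expectation (\<lambda>\<omega>. \<Phi> (hist (Suc n) \<omega>)) = expectation (\<lambda>\<omega>. \<Phi> (hist n \<omega>))"
      unfolding expectation_hist_Suc using harmonic[OF hist_neq_Nil] by simp
    with Suc show ?case by simp
  qed simp
  have "expectation (\<lambda>\<omega>. \<Phi> (hist 0 \<omega>)) = expectation (\<lambda>\<omega>. \<Phi> [0])"
    by (intro integral_cong_AE) (use start in \<open>auto\<close>)
  also have "\<dots> = \<Phi> [0]" by (simp add: prob_space)
  also have "\<dots> = (\<Prod>z<v. pass_prob b z z)"
  proof (cases "v = 0")
    case False
    then have "{..<v} = insert 0 {0<..<v}" by auto
    then show ?thesis using b_le[of 0] by (simp add: \<Phi>_def Q_def)
  qed (use b_0[of 0] in \<open>simp add: \<Phi>_def Q_def pass_prob_def\<close>)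
  finally have init: "expectation (\<lambda>\<omega>. \<Phi> (hist 0 \<omega>)) = (\<Prod>z<v. pass_prob b z z)" .
  have lim: "AE \<omega> in M. (\<lambda>n. \<Phi> (hist n \<omega>)) \<longlonglongrightarrow> indicator A \<omega>"
    using AE_tends_to_infinity AE_space
  proof eventually_elim
    case (elim \<omega>)
    obtain N where N: "\<And>n. n \<ge> N \<Longrightarrow> v < X n \<omega>"
      using elim(1) by (auto simp: eventually_sequentially)
    have Max_ge: "v \<le> Max (set (hist n \<omega>))" if "N \<le> n" for n
      using N[OF that] hd_le[of "hist n \<omega>"] by simp
    have \<Phi>_late: "\<Phi> (hist n \<omega>) = of_bool (hist_above b (hist n \<omega>))" if "N \<le> n" for n
      using Max_ge[OF that] b_0[OF Max_ge[OF that]] by (simp add: \<Phi>_def pass_prob_def Q_def)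
    have "hist_above b (hist n \<omega>) \<longleftrightarrow> above_barrier b (\<lambda>k. X k \<omega>)" if "N \<le> n" for n
    proof
      assume *: "hist_above b (hist n \<omega>)"
      show "above_barrier b (\<lambda>k. X k \<omega>)"
        unfolding above_barrier_def
      proof
        fix k
        show "b (Max ((\<lambda>k. X k \<omega>) ` {..k})) \<le> X k \<omega>"
        proof (cases "k \<le> n")
          case False
          then show ?thesis using b_0[OF Max_ge[of k]] that by (simp add: set_hist)
        qed (use * in \<open>simp add: hist_above_hist\<close>)
      qed
    qed (simp add: above_barrier_iff)
    then have "\<forall>\<^sub>F n in sequentially. \<Phi> (hist n \<omega>) = indicator A \<omega>"
      using elim(2) \<Phi>_late by (auto simp: eventually_sequentially A_def intro!: exI[of _ N])
    then show ?case by (rule tendsto_eventually)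
  qed
  have "(\<lambda>n. expectation (\<lambda>\<omega>. \<Phi> (hist n \<omega>))) \<longlonglongrightarrow> expectation (indicator A)"
    by (rule integral_dominated_convergence[where w = "\<lambda>_. 1"]) (use lim \<Phi>_bounds in auto)
  then have "expectation (indicator A) = (\<Prod>z<v. pass_prob b z z)"
    by (simp only: trans[OF const init] LIMSEQ_const_iff)
  then show ?thesis by (simp add: A_def)
qed

text \<open>Setting the barrier to \<open>0\<close> from level \<open>v\<close> on leaves finitely
  many levels; the resulting events decrease to the full barrier event as \<open>v\<close>
  grows.\<close>

lemma prob_above_barrier:
  assumes b_le: "\<And>z. b z \<le> z"
  shows "(\<lambda>v. \<Prod>z<v. pass_prob b z z) \<longlonglongrightarrow> prob {\<omega>\<in>space M. above_barrier b (\<lambda>k. X k \<omega>)}"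
proof -
  define c where "c v z = (if z < v then b z else 0)" for v z
  define A where "A v = {\<omega>\<in>space M. above_barrier (c v) (\<lambda>k. X k \<omega>)}" for v
  have "(\<lambda>v. prob (A v)) \<longlonglongrightarrow> prob (\<Inter>v. A v)"
  proof (rule finite_Lim_measure_decseq)
    show "decseq A"
    proof (rule decseq_SucI)
      fix v
      have "c v z \<le> c (Suc v) z" for z by (simp add: c_def)
      then show "A (Suc v) \<subseteq> A v"
        unfolding A_def above_barrier_def by (auto intro: order_trans)
    qed
  qed (auto simp: A_def)
  also have "(\<Inter>v. A v) = {\<omega>\<in>space M. above_barrier b (\<lambda>k. X k \<omega>)}"
  proof -
    have "above_barrier b x \<longleftrightarrow> (\<forall>v. above_barrier (c v) x)" for x
    proof -
      have "b z \<le> m \<longleftrightarrow> (\<forall>v. c v z \<le> m)" for z m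
        by (auto simp: c_def dest: spec[of _ "Suc z"])
      then show ?thesis unfolding above_barrier_def by metis
    qed
    then show ?thesis by (auto simp: A_def)
  qed
  also have "(\<lambda>v. prob (A v)) = (\<lambda>v. \<Prod>z<v. pass_prob b z z)"
  proof
    fix v
    have "prob (A v) = (\<Prod>z<v. pass_prob (c v) z z)"
      unfolding A_def using b_le by (intro prob_above_barrier_finite) (auto simp: c_def)
    also have "\<dots> = (\<Prod>z<v. pass_prob b z z)"
      by (intro prod.cong) (auto simp: pass_prob_def c_def)
    finally show "prob (A v) = (\<Prod>z<v. pass_prob b z z)" .
  qed
  finally show ?thesis .
qed

end

section \<open>Sites visited once\<close>

definition transient_path :: "(nat \<Rightarrow> nat) \<Rightarrow> bool" where
  "transient_path x \<longleftrightarrow> x 0 = 0 \<and> (\<forall>n. x (Suc n) = Suc (x n) \<or> Suc (x (Suc n)) = x n)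
     \<and> (\<forall>s. \<forall>\<^sub>F n in sequentially. s < x n)"

text \<open>Discrete intermediate value theorem for a path with unit steps.\<close>

lemma transient_path_hits:
  assumes "transient_path x" "a \<le> b" "x a \<le> s" "s \<le> x b"
  obtains k where "a \<le> k" "k \<le> b" "x k = s"
proof -
  have "\<exists>k. a \<le> k \<and> k \<le> b \<and> x k = s"
    using assms(2,3,4)
  proof (induction b rule: dec_induct)
    case (step b)
    have "x (Suc b) = Suc (x b) \<or> Suc (x (Suc b)) = x b"
      using assms(1) by (auto simp: transient_path_def)
    then consider "s \<le> x b" | "s = x (Suc b)" using step.prems by linarith
    then show ?case using step by cases (auto intro: le_SucI)
  qed auto
  then show ?thesis using that by blast
qed

lemma transient_path_hits_after:
  assumes "transient_path x" "x a \<le> s"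
  obtains k where "a \<le> k" "x k = s"
proof -
  obtain N where "\<And>n. n \<ge> N \<Longrightarrow> s < x n"
    using assms(1) unfolding transient_path_def eventually_sequentially by blast
  then have "s \<le> x (max a N)" by (simp add: less_imp_le)
  then show ?thesis
    using transient_path_hits[OF assms(1) _ assms(2), of "max a N"] that by auto
qed

text \<open>This barrier forces the walk straight up on \<open>R, \<dots>, R + L\<close> and afterwards
  forbids any return to \<open>R + L\<close>.\<close>

definition straight_barrier :: "nat \<Rightarrow> nat \<Rightarrow> nat \<Rightarrow> nat" where
  "straight_barrier R L z = (if z < R then 0 else min z (Suc (R + L)))"

text \<open>At the first visit to \<open>s\<close> the running maximum is \<open>s\<close>, and so
  is the barrier, which rules out a step down. The step up then raises the barrier above
  \<open>s\<close> for good.\<close>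

lemma local_time_eq_1_if_above_barrier:
  assumes path: "transient_path (\<lambda>k. X k \<omega>)"
    and above: "above_barrier (straight_barrier R L) (\<lambda>k. X k \<omega>)"
    and s: "R \<le> s" "s \<le> R + L"
  shows "local_time X s \<omega> = 1"
proof -
  define x where "x = (\<lambda>k. X k \<omega>)"
  have px: "transient_path x" and ax: "straight_barrier R L (Max (x ` {..m})) \<le> x m" for m
    using path above by (auto simp: x_def above_barrier_def)
  have x0: "x 0 \<le> s" using px by (simp add: transient_path_def)
  obtain k where k: "x k = s" using transient_path_hits_after[OF px x0] by blast
  define n where "n = (LEAST k. x k = s)"
  have n: "x n = s" and least: "k < n \<Longrightarrow> x k \<noteq> s" for k
    unfolding n_def using k by (auto intro: LeastI dest: not_less_Least)
  have before: "x k \<le> s" if "k \<le> n" for k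
  proof (rule ccontr)
    assume "\<not> x k \<le> s"
    then obtain k' where "k' \<le> k" "x k' = s" "k \<noteq> n"
      using transient_path_hits[OF px _ x0, of k] n by auto
    then show False using least[of k'] that by auto
  qed
  have "Suc (x (Suc n)) \<noteq> s"
  proof
    assume eq: "Suc (x (Suc n)) = s"
    then have "Max (x ` {..Suc n}) = s"
    proof (intro Max_eqI)
      show "y \<le> s" if "y \<in> x ` {..Suc n}" for y
        using that before eq by (metis atMost_iff imageE le_Suc_eq less_or_eq_imp_le lessI)
      show "s \<in> x ` {..Suc n}" using n by (metis atMost_iff imageI lessI less_imp_le)
    qed simp
    then show False using ax[of "Suc n"] s eq by (auto simp: straight_barrier_def)
  qed
  then have up: "x (Suc n) = Suc s" using px n by (auto simp: transient_path_def)
  have after: "s < x m" if "n < m" for m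
  proof -
    have "Suc s \<le> Max (x ` {..m})" using up that by (intro Max_ge) (auto intro!: image_eqI[of _ _ "Suc n"])
    moreover have "Suc s \<le> straight_barrier R L z" if "Suc s \<le> z" for z
      using s that by (auto simp: straight_barrier_def)
    ultimately show ?thesis using ax[of m] Suc_le_lessD le_trans by blast
  qed
  have "{k. x k = s} = {n}"
    using n least after by (auto) (metis linorder_neqE_nat less_irrefl)
  then show ?thesis by (simp add: local_time_def x_def one_enat_def)
qed

text \<open>A breach of the barrier forces two visits to some site of the run.\<close>

lemma above_barrier_if_local_time_le_1:
  assumes path: "transient_path (\<lambda>k. X k \<omega>)"
    and le: "\<And>s. R \<le> s \<Longrightarrow> s \<le> R + L \<Longrightarrow> local_time X s \<omega> \<le> 1"
  shows "above_barrier (straight_barrier R L) (\<lambda>k. X k \<omega>)"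
  unfolding above_barrier_def
proof (rule ccontr)
  define x where "x = (\<lambda>k. X k \<omega>)"
  have px: "transient_path x" using path by (simp add: x_def)
  assume "\<not> (\<forall>n. straight_barrier R L (Max ((\<lambda>k. X k \<omega>) ` {..n})) \<le> X n \<omega>)"
  then obtain n where n: "x n < straight_barrier R L (Max (x ` {..n}))"
    by (auto simp: x_def not_le)
  have "Max (x ` {..n}) \<in> x ` {..n}" by (intro Max_in) auto
  then obtain m where m: "m \<le> n" "x m = Max (x ` {..n})"
    by (metis atMost_iff imageE)
  \<comment> \<open>This site of the run lies between \<open>x n\<close> and the earlier maximum
    \<open>x m\<close>. It is visited on the way up to \<open>x m\<close>, and again from time
    \<open>n\<close> on because the path tends to infinity.\<close>
  define s where "s = min (x m) (R + L)"
  have y: "R \<le> x m" "x n < x m" "x n \<le> R + L"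
    using n[folded m(2)] by (auto simp: straight_barrier_def split: if_splits)
  have "x 0 \<le> s" using px by (simp add: transient_path_def)
  then obtain k1 where k1: "k1 \<le> m" "x k1 = s"
    using transient_path_hits[OF px, of 0 m s] by (auto simp: s_def)
  obtain k2 where k2: "n \<le> k2" "x k2 = s"
    using transient_path_hits_after[OF px, of n s] y by (auto simp: s_def)
  have "m \<noteq> n" using y by auto
  with k1 k2 m have "k1 \<noteq> k2" by linarith
  obtain N where N: "\<And>n. n \<ge> N \<Longrightarrow> s < x n"
    using px unfolding transient_path_def eventually_sequentially by blast
  have "{k. x k = s} \<subseteq> {..<N}" using N by (auto simp: not_less[symmetric])
  then have fin: "finite {k. x k = s}" by (rule finite_subset) simp
  have "card {k1, k2} \<le> card {k. x k = s}"
    using k1 k2 by (intro card_mono fin) auto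
  then have "\<not> local_time X s \<omega> \<le> 1"
    using fin \<open>k1 \<noteq> k2\<close> by (auto simp: local_time_def x_def one_enat_def)
  moreover have "R \<le> s" "s \<le> R + L" using y by (auto simp: s_def)
  ultimately show False using le by blast
qed

lemma (in transient_walk) AE_transient_path: "AE \<omega> in M. transient_path (\<lambda>k. X k \<omega>)"
  using start AE_nearest_neighbour AE_tends_to_infinity
  by eventually_elim (simp add: transient_path_def)

section \<open>Probabilities of single-visit runs and of pairs of them\<close>

context transient_walk begin

text \<open>On transient paths this is exactly the event that each of \<open>R, ..., R + L\<close>
  is visited once; in the barrier form its probability is a product.\<close>

definition straight :: "nat \<Rightarrow> nat \<Rightarrow> 'a set" where
  "straight R L = {\<omega>\<in>space M. above_barrier (straight_barrier R L) (\<lambda>k. X k \<omega>)}"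

lemma straight_measurable [measurable]: "straight R L \<in> sets M"
  unfolding straight_def by measurable

abbreviation "straight_factor R L z \<equiv> pass_prob (straight_barrier R L) z z"

lemma straight_barrier_le: "straight_barrier R L z \<le> z"
  by (simp add: straight_barrier_def)

lemma straight_factor_below: "z < R \<Longrightarrow> straight_factor R L z = 1"
  by (simp add: pass_prob_def straight_barrier_def)

text \<open>The barrier at \<open>z\<close> is \<open>z\<close> itself, so level \<open>z\<close> is
  passed only by stepping up at once.\<close>

lemma straight_factor_run:
  assumes "1 \<le> R" "R \<le> z" "z \<le> R + L"
  shows "straight_factor R L z = E z"
proof -
  obtain y where z: "z = Suc y" using assms by (cases z) auto
  have "E z * (r y + r z) = r y" using balance[of y] by (simp add: z algebra_simps)
  moreover have "T y - T z = r y" "T y - T (Suc z) = r y + r z"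
    using T_Suc[of y] T_Suc[of z] by (auto simp: z)
  moreover have "r y + r z > 0" using r_pos[of y] r_pos[of z] by simp
  ultimately show ?thesis
    using assms by (simp add: pass_prob_def straight_barrier_def z field_simps)
qed

lemma straight_factor_above:
  "R + L < z \<Longrightarrow> straight_factor R L z = (T (R + L) - T z) / (T (R + L) - T (Suc z))"
  by (simp add: pass_prob_def straight_barrier_def)

lemma prod_straight_factor_run:
  assumes "1 \<le> R" "v \<le> Suc (R + L)"
  shows "(\<Prod>z<v. straight_factor R L z) = (\<Prod>z=R..<v. E z)"
proof -
  have "(\<Prod>z<v. straight_factor R L z) = (\<Prod>z=R..<v. straight_factor R L z)"
    by (rule prod.mono_neutral_right) (auto simp: straight_factor_below)
  also have "\<dots> = (\<Prod>z=R..<v. E z)"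
    using assms by (intro prod.cong) (auto simp: straight_factor_run)
  finally show ?thesis .
qed

text \<open>Above \<open>R + L\<close> the factors telescope; the numerator left over is
  \<open>T (R + L) - T (Suc (R + L)) = r (R + L)\<close>.\<close>

lemma prod_straight_factor:
  assumes "1 \<le> R" "Suc (R + L) \<le> v"
  shows "(\<Prod>z<v. straight_factor R L z) = (\<Prod>z=R..R+L. E z) * (r (R + L) / (T (R + L) - T v))"
  using assms(2)
proof (induction v rule: dec_induct)
  case base
  have "T (R + L) - T (Suc (R + L)) = r (R + L)" using T_Suc[of "R + L"] by simp
  moreover have "{R..<Suc (R + L)} = {R..R + L}" by auto
  ultimately show ?case
    using prod_straight_factor_run[OF assms(1), of "Suc (R + L)" L] r_pos[of "R + L"] by simp
next
  case (step v)
  have "T (R + L) - T v \<noteq> 0" using T_less[of "R + L" v] step by simp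
  then show ?case using step by (simp add: straight_factor_above)
qed

text \<open>The straight ascent through the run, times the probability of never returning from
  \<open>R + L + 1\<close> to \<open>R + L\<close>; the latter arises as \<open>v\<close> tends to
  infinity.\<close>

lemma prob_straight:
  assumes "1 \<le> R"
  shows "prob (straight R L) = (\<Prod>z=R..R+L. E z) * (r (R + L) / T (R + L))"
proof (rule LIMSEQ_unique)
  show "(\<lambda>v. \<Prod>z<v. straight_factor R L z) \<longlonglongrightarrow> prob (straight R L)"
    unfolding straight_def by (rule prob_above_barrier) (rule straight_barrier_le)
  have lim: "(\<lambda>v. (\<Prod>z=R..R+L. E z) * (r (R + L) / (T (R + L) - T v)))
      \<longlonglongrightarrow> (\<Prod>z=R..R+L. E z) * (r (R + L) / (T (R + L) - 0))"
    using T_pos[of "R + L"] by (intro tendsto_intros T_tendsto_0) auto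
  have "\<forall>\<^sub>F v in sequentially.
      (\<Prod>z=R..R+L. E z) * (r (R + L) / (T (R + L) - T v)) = (\<Prod>z<v. straight_factor R L z)"
    using eventually_ge_at_top[of "Suc (R + L)"]
    by eventually_elim (simp add: prod_straight_factor[OF assms])
  then show "(\<lambda>v. \<Prod>z<v. straight_factor R L z)
      \<longlonglongrightarrow> (\<Prod>z=R..R+L. E z) * (r (R + L) / T (R + L))"
    using Lim_transform_eventually[OF lim] by simp
qed

text \<open>One barrier, that of the first run below \<open>S\<close> and that of the second from
  \<open>S\<close> on, is weaker than the two together, and its product splits at
  \<open>S\<close>.\<close>

lemma prob_straight_Int_le:
  assumes "R < S"
  shows "prob (straight R L \<inter> straight S K)
    \<le> (\<Prod>z<S. straight_factor R L z) * prob (straight S K)"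
proof -
  define b where "b z = (if z < S then straight_barrier R L z else straight_barrier S K z)" for z
  have "(\<lambda>v. \<Prod>z<v. pass_prob b z z) \<longlonglongrightarrow> (\<Prod>z<S. straight_factor R L z) * prob (straight S K)"
  proof -
    have split: "(\<Prod>z<v. f z) = (\<Prod>z<S. f z) * (\<Prod>z=S..<v. f z)" if "S \<le> v" for f :: "nat \<Rightarrow> real" and v
      using that by (simp add: prod.atLeastLessThan_concat lessThan_atLeast0)
    have "(\<Prod>z<v. pass_prob b z z) = (\<Prod>z<S. straight_factor R L z) * (\<Prod>z<v. straight_factor S K z)"
      if "S \<le> v" for v
    proof -
      have "(\<Prod>z<S. straight_factor S K z) = 1"
        by (intro prod.neutral) (auto simp: straight_factor_below)
      moreover have "(\<Prod>z<S. pass_prob b z z) = (\<Prod>z<S. straight_factor R L z)"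
        by (intro prod.cong) (auto simp: pass_prob_def b_def)
      moreover have "(\<Prod>z=S..<v. pass_prob b z z) = (\<Prod>z=S..<v. straight_factor S K z)"
        by (intro prod.cong) (auto simp: pass_prob_def b_def)
      ultimately show ?thesis using split[OF that] by simp
    qed
    then have "\<forall>\<^sub>F v in sequentially. (\<Prod>z<S. straight_factor R L z) * (\<Prod>z<v. straight_factor S K z)
        = (\<Prod>z<v. pass_prob b z z)"
      by (intro eventually_sequentiallyI[of S]) (simp only:)
    moreover have "(\<lambda>v. (\<Prod>z<S. straight_factor R L z) * (\<Prod>z<v. straight_factor S K z))
        \<longlonglongrightarrow> (\<Prod>z<S. straight_factor R L z) * prob (straight S K)"
      unfolding straight_def
      by (intro tendsto_mult_left prob_above_barrier) (rule straight_barrier_le)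
    ultimately show ?thesis by (rule Lim_transform_eventually[rotated])
  qed
  moreover have "(\<lambda>v. \<Prod>z<v. pass_prob b z z) \<longlonglongrightarrow> prob {\<omega>\<in>space M. above_barrier b (\<lambda>k. X k \<omega>)}"
    by (rule prob_above_barrier) (simp add: b_def straight_barrier_le)
  ultimately have eq: "prob {\<omega>\<in>space M. above_barrier b (\<lambda>k. X k \<omega>)}
      = (\<Prod>z<S. straight_factor R L z) * prob (straight S K)"
    by (rule LIMSEQ_unique[rotated])
  have "prob (straight R L \<inter> straight S K) \<le> prob {\<omega>\<in>space M. above_barrier b (\<lambda>k. X k \<omega>)}"
  proof (rule finite_measure_mono)
    show "straight R L \<inter> straight S K \<subseteq> {\<omega>\<in>space M. above_barrier b (\<lambda>k. X k \<omega>)}"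
      unfolding straight_def above_barrier_def b_def by auto
  qed measurable
  then show ?thesis by (simp only: eq)
qed

end

section \<open>The drift B / (4 i)\<close>

lemma drift_eq:
  obtains n0 where "1 \<le> n0" "\<And>i. n0 \<le> i \<Longrightarrow> drift B i = B / (4 * real i)"
proof -
  define i0 where "i0 = (LEAST i. 1 \<le> i \<and> B / (4 * real i) < 1 / 2)"
  have "drift B i = (if i0 \<le> i then B / (4 * real i) else B / (4 * real i0))" for i
    unfolding drift_def i0_def Let_def ..
  then show ?thesis using that[of "max 1 i0"] by simp
qed

lemma weight_drift_step:
  assumes "0 < B" "drift B (Suc n) = B / (4 * real (Suc n))"
  shows "(2 * real (Suc n) + B) * weight (drift B) (Suc n) = (2 * real (Suc n) - B) * weight (drift B) n"
proof -
  have "odds (drift B) (Suc n) = (2 * real (Suc n) - B) / (2 * real (Suc n) + B)"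
  proof -
    define m where "m = real (Suc n)"
    have "0 < m" by (simp add: m_def)
    then have "1 / 2 - B / (4 * m) = (2 * m - B) / (4 * m)" "1 / 2 + B / (4 * m) = (2 * m + B) / (4 * m)"
      by (simp_all add: field_simps)
    moreover have "odds (drift B) (Suc n) = (1 / 2 - B / (4 * m)) / (1 / 2 + B / (4 * m))"
      using assms(2) by (simp add: odds_def up_prob_def m_def)
    ultimately show ?thesis using \<open>0 < m\<close> unfolding m_def[symmetric] by simp
  qed
  then show ?thesis using assms(1) by (simp add: weight_Suc)
qed

text \<open>Writes \<open>weight\<close> as an exact difference. This yields both its summability
  for \<open>1 < B\<close> and the closed form of its tail sums.\<close>

lemma weight_drift_telescope:
  assumes "0 < B" "drift B (Suc n) = B / (4 * real (Suc n))"
  shows "(2 * real n + B) * weight (drift B) n - (2 * real (Suc n) + B) * weight (drift B) (Suc n)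
    = 2 * (B - 1) * weight (drift B) n"
  unfolding weight_drift_step[OF assms] by (simp add: algebra_simps)

lemma weight_nonneg:
  assumes "\<And>i. 1 \<le> i \<Longrightarrow> 0 \<le> p i \<and> p i < 1 / 2"
  shows "0 \<le> weight p k"
  unfolding weight_def odds_def up_prob_def using assms
  by (intro prod_nonneg ballI divide_nonneg_nonneg) (auto simp: less_imp_le Suc_le_eq)

lemma summable_weight_drift:
  assumes "1 < B"
  shows "summable (weight (drift B))"
proof -
  obtain n0 where n0: "\<And>i. n0 \<le> i \<Longrightarrow> drift B i = B / (4 * real i)"
    using drift_eq by blast
  define w where "w n = (2 * real n + B) * weight (drift B) n" for n
  have nonneg: "0 \<le> weight (drift B) n" for n
    using drift_bounds[of B] assms by (intro weight_nonneg) auto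
  then have w_nonneg: "0 \<le> w n" for n using assms by (simp add: w_def)
  have step: "w (k + n0) - w (Suc k + n0) = 2 * (B - 1) * weight (drift B) (k + n0)" for k
    using weight_drift_telescope[of B "k + n0"] assms n0 by (simp add: w_def)
  have "2 * (B - 1) * (\<Sum>k<m. weight (drift B) (k + n0)) = w n0 - w (m + n0)" for m
  proof (induction m)
    case (Suc m)
    have "2 * (B - 1) * (\<Sum>k<Suc m. weight (drift B) (k + n0))
        = 2 * (B - 1) * (\<Sum>k<m. weight (drift B) (k + n0)) + 2 * (B - 1) * weight (drift B) (m + n0)"
      by (simp add: distrib_left)
    then show ?case using Suc step[of m] by simp
  qed simp
  then have "2 * (B - 1) * (\<Sum>k<m. weight (drift B) (k + n0)) \<le> w n0" for m
    using w_nonneg[of "m + n0"] by simp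
  then have le: "(\<Sum>k<m. weight (drift B) (k + n0)) \<le> w n0 / (2 * (B - 1))" for m
    using assms by (simp add: pos_le_divide_eq mult.commute)
  have "summable (\<lambda>k. weight (drift B) (k + n0))"
    using le nonneg by (intro bounded_imp_summable[where B = "w n0 / (2 * (B - 1))"])
      (auto simp flip: lessThan_Suc_atMost simp del: sum.lessThan_Suc)
  then show ?thesis by (simp add: summable_iff_shift)
qed

locale drift_walk = nn_walk M "drift B" X
  for M :: "'a measure" and B :: real and X :: "nat \<Rightarrow> 'a \<Rightarrow> nat" +
  assumes B_gt_1: "1 < B"

sublocale drift_walk \<subseteq> transient_walk M "drift B" X
  using drift_bounds[of B] B_gt_1 by unfold_locales (auto intro: summable_weight_drift)

section \<open>Estimates for the walk with drift \<open>B / (4 i)\<close>\<close>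

context drift_walk begin

lemma eventually_E_eq: "\<forall>\<^sub>F n in sequentially. E n = 1 / 2 * (1 + B / (2 * real n))"
proof -
  obtain n0 where "1 \<le> n0" and n0: "\<And>i. n0 \<le> i \<Longrightarrow> drift B i = B / (4 * real i)"
    using drift_eq by blast
  have "E n = 1 / 2 * (1 + B / (2 * real n))" if "n0 \<le> n" for n
    using n0[OF that] that \<open>1 \<le> n0\<close> by (simp add: up_prob_def)
  then show ?thesis unfolding eventually_sequentially by blast
qed

text \<open>The difference \<open>D n\<close> of the two sides is constant from \<open>n0\<close>
  on. A positive constant would keep \<open>r n\<close> above a multiple of \<open>1 / n\<close>,
  against summability; a negative one contradicts \<open>D n \<ge> - (2 * (B - 1) * T n)\<close>,
  whose right side tends to \<open>0\<close>.\<close>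

lemma eventually_T_eq: "\<forall>\<^sub>F n in sequentially. 2 * (B - 1) * T n = (2 * real n + B) * r n"
proof -
  obtain n0 where n0: "\<And>i. n0 \<le> i \<Longrightarrow> drift B i = B / (4 * real i)"
    using drift_eq by blast
  define D where "D n = (2 * real n + B) * r n - 2 * (B - 1) * T n" for n
  have D_Suc: "D (Suc n) = D n" if "n0 \<le> n" for n
  proof -
    have "2 * (B - 1) * T n = 2 * (B - 1) * r n + 2 * (B - 1) * T (Suc n)"
      by (subst T_Suc) (simp only: distrib_left)
    then show ?thesis
      using weight_drift_telescope[of B n] n0[of "Suc n"] that B_gt_1 by (simp add: D_def)
  qed
  have D_const: "D n = D n0" if "n0 \<le> n" for n
    using that by (induction n rule: dec_induct) (auto simp: D_Suc)
  have D_le: "D n \<le> (2 * real n + B) * r n" for n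
    using T_pos[of n] B_gt_1 by (simp add: D_def)
  have D_nonpos: "D n0 \<le> 0"
  proof (rule ccontr)
    assume pos: "\<not> D n0 \<le> 0"
    have "inverse (real (Suc n)) \<le> (2 + B) / D n0 * r n" if "n0 \<le> n" for n
    proof -
      have "D n0 \<le> (2 * real n + B) * r n" using D_le[of n] D_const[OF that] by simp
      also have "\<dots> \<le> ((2 + B) * real (Suc n)) * r n"
        using r_pos[of n] B_gt_1 by (intro mult_right_mono) (auto simp: algebra_simps)
      finally show ?thesis using pos by (simp add: field_simps)
    qed
    then have "\<forall>\<^sub>F n in sequentially. norm (inverse (real (Suc n))) \<le> (2 + B) / D n0 * r n"
      by (auto simp: eventually_sequentially)
    then have "summable (\<lambda>n. inverse (real (Suc n)))"
      by (rule summable_comparison_test_ev) (intro summable_mult summable_weight)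
    then show False
      using not_summable_harmonic[where 'a = real] by (subst (asm) summable_Suc_iff) simp
  qed
  have "- (2 * (B - 1) * T n) \<le> D n" for n
    using r_pos[of n] B_gt_1 by (simp add: D_def)
  then have "\<forall>\<^sub>F n in sequentially. - (2 * (B - 1) * T n) \<le> D n0"
    using D_const by (intro eventually_sequentiallyI[of n0]) metis
  moreover have "(\<lambda>n. - (2 * (B - 1) * T n)) \<longlonglongrightarrow> - (2 * (B - 1) * 0)"
    by (intro tendsto_intros T_tendsto_0)
  ultimately have "0 \<le> D n0" using tendsto_upperbound by fastforce
  with D_nonpos have "D n = 0" if "n0 \<le> n" for n using D_const[OF that] by simp
  then show ?thesis by (intro eventually_sequentiallyI[of n0]) (simp add: D_def)
qed

text \<open>The tail formula gives \<open>T (Suc S) = (1 - a) * T S\<close>, and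
  \<open>(1 - a) * (1 + q + a) \<le> 1 + q\<close> trades the product of these factors for a
  sum.\<close>

lemma tail_decay:
  assumes tail: "\<And>n. R \<le> n \<Longrightarrow> 2 * (B - 1) * T n = (2 * real n + B) * r n" and "R \<le> S"
  shows "T S * (1 + (\<Sum>n=R..<S. 2 * (B - 1) / (2 * real n + B))) \<le> T R"
  using \<open>R \<le> S\<close>
proof (induction S rule: dec_induct)
  case (step S)
  define a where "a = 2 * (B - 1) / (2 * real S + B)"
  define q where "q = (\<Sum>n=R..<S. 2 * (B - 1) / (2 * real n + B))"
  have "0 \<le> a" "0 \<le> q" using B_gt_1 by (auto simp: a_def q_def intro!: sum_nonneg)
  have "2 * real S + B > 0" using B_gt_1 by simp
  then have "r S = a * T S" using tail[OF step(1)] by (simp add: a_def field_simps)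
  then have "T (Suc S) = (1 - a) * T S" using T_Suc[of S] by (simp add: algebra_simps)
  then have "T (Suc S) * (1 + (q + a)) = T S * ((1 - a) * (1 + (q + a)))" by simp
  also have "\<dots> \<le> T S * (1 + q)"
    using T_pos[of S] \<open>0 \<le> a\<close> \<open>0 \<le> q\<close> by (intro mult_left_mono) (auto simp: algebra_simps)
  also have "\<dots> \<le> T R" using step by (simp add: q_def)
  finally show ?case using step(1) by (simp add: a_def q_def)
qed simp

text \<open>The first bound serves for \<open>S\<close> of the order of \<open>R\<close>; the
  second, an integral comparison, shows that the sum becomes large with
  \<open>S / R\<close>.\<close>

lemma escape_sum_ge:
  assumes "R < S"
  shows "(real S - real R) * (2 * (B - 1) / (2 * real S + B)) \<le> (\<Sum>n=R..<S. 2 * (B - 1) / (2 * real n + B))"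
    and "(B - 1) * ln ((2 * real S + B) / (2 * real R + B)) \<le> (\<Sum>n=R..<S. 2 * (B - 1) / (2 * real n + B))"
proof -
  have "(\<Sum>n=R..<S. 2 * (B - 1) / (2 * real S + B)) \<le> (\<Sum>n=R..<S. 2 * (B - 1) / (2 * real n + B))"
    using B_gt_1 by (intro sum_mono divide_left_mono) auto
  then show "(real S - real R) * (2 * (B - 1) / (2 * real S + B)) \<le> (\<Sum>n=R..<S. 2 * (B - 1) / (2 * real n + B))"
    using assms by (simp add: of_nat_diff)
  have "(\<Sum>n=R..<S. (B - 1) * (ln (2 * real (Suc n) + B) - ln (2 * real n + B)))
      \<le> (\<Sum>n=R..<S. (B - 1) * (2 / (2 * real n + B)))"
  proof (intro sum_mono mult_left_mono)
    fix n
    show "ln (2 * real (Suc n) + B) - ln (2 * real n + B) \<le> 2 / (2 * real n + B)"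
      using B_gt_1 by (intro order_trans[OF ln_diff_le]) auto
  qed (use B_gt_1 in auto)
  moreover have "(\<Sum>n=R..<S. (B - 1) * (ln (2 * real (Suc n) + B) - ln (2 * real n + B)))
      = (B - 1) * (ln (2 * real S + B) - ln (2 * real R + B))"
    using assms sum_Suc_diff'[of R S "\<lambda>n. ln (2 * real n + B)"] by (simp flip: sum_distrib_left)
  moreover have "ln ((2 * real S + B) / (2 * real R + B)) = ln (2 * real S + B) - ln (2 * real R + B)"
    using B_gt_1 by (intro ln_divide_pos) auto
  ultimately show "(B - 1) * ln ((2 * real S + B) / (2 * real R + B)) \<le> (\<Sum>n=R..<S. 2 * (B - 1) / (2 * real n + B))"
    by (simp add: mult.commute)
qed

text \<open>The run contributes \<open>Suc L\<close> factors close to \<open>1 / 2\<close>, and the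
  escape probability \<open>q\<close> after it is of order \<open>1 / R\<close>.\<close>

lemma prob_straight_bounds:
  obtains c C where "0 < c" "0 < C"
    "\<forall>\<^sub>F R in sequentially. \<forall>L. Suc L \<le> R \<longrightarrow>
       c * (1 / 2) ^ Suc L / real R \<le> prob (straight R L) \<and> prob (straight R L) \<le> C * (1 / 2) ^ Suc L / real R"
proof -
  \<comment> \<open>By \<open>Suc L \<le> R\<close> the denominator of \<open>q\<close> is at most
    \<open>(4 + B) * R\<close>, and the factors \<open>1 + B / (2 * R)\<close> by which the run
    exceeds powers of \<open>1 / 2\<close> multiply to at most \<open>exp (B / 2)\<close>.\<close>
  define c where "c = 2 * (B - 1) / (4 + B)"
  define C where "C = exp (B / 2) * (B - 1)"
  obtain n0 where n0: "\<And>n. n \<ge> n0 \<Longrightarrow> E n = 1 / 2 * (1 + B / (2 * real n))"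
    "\<And>n. n \<ge> n0 \<Longrightarrow> 2 * (B - 1) * T n = (2 * real n + B) * r n"
    using eventually_conj[OF eventually_E_eq eventually_T_eq] by (auto simp: eventually_sequentially)
  have "c * (1 / 2) ^ Suc L / real R \<le> prob (straight R L) \<and> prob (straight R L) \<le> C * (1 / 2) ^ Suc L / real R"
    if R: "max 1 n0 \<le> R" and L: "Suc L \<le> R" for R L
  proof -
    define P where "P = (\<Prod>z=R..R+L. E z)"
    define q where "q = 2 * (B - 1) / (2 * real (R + L) + B)"
    have R_pos: "0 < real R" using R by simp
    have "2 * real (R + L) + B > 0" using B_gt_1 by simp
    then have q: "r (R + L) / T (R + L) = q"
      using n0(2)[of "R + L"] R T_pos[of "R + L"] by (simp add: q_def field_simps)
    have prob: "prob (straight R L) = P * q"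
      using prob_straight[of R L] R q by (simp add: P_def)
    have "(\<Prod>z=R..R+L. 1 / 2) \<le> P"
      unfolding P_def by (intro prod_mono conjI E_ge_half) simp
    then have P_ge: "(1 / 2) ^ Suc L \<le> P" by simp
    have "P \<le> (\<Prod>z=R..R+L. 1 / 2 * (1 + B / (2 * real R)))"
      unfolding P_def
    proof (intro prod_mono conjI)
      fix z assume z: "z \<in> {R..R + L}"
      then have "B / (2 * real z) \<le> B / (2 * real R)"
        using R_pos B_gt_1 by (intro divide_left_mono) auto
      then show "E z \<le> 1 / 2 * (1 + B / (2 * real R))" using n0(1)[of z] z R by simp
    qed (simp add: E_pos less_imp_le)
    also have "\<dots> = (1 / 2) ^ Suc L * (1 + B / (2 * real R)) ^ Suc L"
    proof -
      have "Suc (R + L) - R = Suc L" by simp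
      then show ?thesis by (simp only: prod_constant card_atLeastAtMost power_mult_distrib)
    qed
    also have "(1 + B / (2 * real R)) ^ Suc L \<le> exp (B / (2 * real R)) ^ Suc L"
      using B_gt_1 by (intro power_mono exp_ge_add_one_self) auto
    also have "\<dots> = exp (real (Suc L) * (B / (2 * real R)))" by (rule exp_of_nat_mult[symmetric])
    also have "\<dots> \<le> exp (B / 2)"
    proof -
      have "real (Suc L) * B \<le> real R * B" using L B_gt_1 by (intro mult_right_mono) auto
      then show ?thesis using R_pos by (simp add: field_simps)
    qed
    finally have P_le: "P \<le> (1 / 2) ^ Suc L * exp (B / 2)" by simp
    have "(B - 1) / real R = 2 * (B - 1) / (2 * real R)"
      using R_pos by (simp add: field_simps)
    then have q_le: "q \<le> (B - 1) / real R"
      unfolding q_def using R_pos B_gt_1 by (simp only:) (intro divide_left_mono; simp)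
    have "B * 1 \<le> B * real R" using R B_gt_1 by (intro mult_left_mono) auto
    then have "2 * real (R + L) + B \<le> (4 + B) * real R"
      using L by (simp add: algebra_simps)
    then have q_ge: "c / real R \<le> q"
      unfolding q_def c_def using R_pos B_gt_1 by (simp only: divide_divide_eq_left) (intro divide_left_mono; simp)
    have "q \<ge> 0" using B_gt_1 by (simp add: q_def)
    have "(1 / 2) ^ Suc L * (c / real R) \<le> P * q"
      using P_ge q_ge R_pos B_gt_1 by (intro mult_mono) (auto simp: c_def intro: order_trans[OF _ P_ge])
    moreover have "P * q \<le> ((1 / 2) ^ Suc L * exp (B / 2)) * ((B - 1) / real R)"
      using P_le q_le \<open>q \<ge> 0\<close> by (intro mult_mono) auto
    ultimately show ?thesis by (simp add: prob C_def mult_ac)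
  qed
  then have "\<forall>\<^sub>F R in sequentially. \<forall>L. Suc L \<le> R \<longrightarrow>
       c * (1 / 2) ^ Suc L / real R \<le> prob (straight R L) \<and> prob (straight R L) \<le> C * (1 / 2) ^ Suc L / real R"
    unfolding eventually_sequentially by blast
  moreover have "0 < c" "0 < C" using B_gt_1 by (auto simp: c_def C_def)
  ultimately show ?thesis using that by blast
qed

text \<open>Rounding the length halves the lower constant. Both constants are chosen before
  \<open>\<epsilon>\<close>.\<close>

lemma eventually_prob_straight_run:
  assumes "1 \<le> N"
  shows "\<exists>c>0. \<exists>C>0. \<forall>\<epsilon>\<ge>0. \<forall>\<^sub>F R in sequentially.
       c * (log_weight N (real R) * exp (- \<epsilon> * iter_log N (real R))) \<le> prob (straight R (nat \<lfloor>run_f N R \<epsilon>\<rfloor>))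
     \<and> prob (straight R (nat \<lfloor>run_f N R \<epsilon>\<rfloor>)) \<le> C * (log_weight N (real R) * exp (- \<epsilon> * iter_log N (real R)))"
proof -
  obtain c C where cC: "0 < c" "0 < C" and bounds:
    "\<forall>\<^sub>F R in sequentially. \<forall>L. Suc L \<le> R \<longrightarrow>
       c * (1 / 2) ^ Suc L / real R \<le> prob (straight R L) \<and> prob (straight R L) \<le> C * (1 / 2) ^ Suc L / real R"
    using prob_straight_bounds by blast
  have "\<forall>\<^sub>F R in sequentially.
       c / 2 * (log_weight N (real R) * exp (- \<epsilon> * iter_log N (real R))) \<le> prob (straight R (nat \<lfloor>run_f N R \<epsilon>\<rfloor>))
     \<and> prob (straight R (nat \<lfloor>run_f N R \<epsilon>\<rfloor>)) \<le> C * (log_weight N (real R) * exp (- \<epsilon> * iter_log N (real R)))"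
    if "0 \<le> \<epsilon>" for \<epsilon>
    using bounds eventually_run_f_bounds[OF assms that] eventually_gt_at_top[of 0]
  proof eventually_elim
    case (elim R)
    define f where "f = run_f N R \<epsilon>"
    define L where "L = nat \<lfloor>f\<rfloor>"
    have f: "0 \<le> f" "f + 1 \<le> real R" using elim by (auto simp: f_def)
    then have "real (Suc L) \<le> real R" by (simp add: L_def) linarith
    then have "Suc L \<le> R" by linarith
    then have *: "c * (1 / 2) ^ Suc L / real R \<le> prob (straight R L)"
        "prob (straight R L) \<le> C * (1 / 2) ^ Suc L / real R"
      using elim(1) by blast+
    note h = half_power_floor[OF f(1), folded L_def]
    have "c / 2 * (2 powr (- f) / real R) = c * (2 powr (- f) / 2) / real R" by simp
    also have "\<dots> \<le> c * (1 / 2) ^ Suc L / real R"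
      using h cC by (intro divide_right_mono mult_left_mono) auto
    finally have lower: "c / 2 * (2 powr (- f) / real R) \<le> prob (straight R L)" using * by linarith
    have "C * (1 / 2) ^ Suc L / real R \<le> C * 2 powr (- f) / real R"
      using h cC by (intro divide_right_mono mult_left_mono) auto
    then have upper: "prob (straight R L) \<le> C * (2 powr (- f) / real R)" using * by simp
    show ?case
      using lower upper unfolding L_def f_def two_powr_minus_run_f[OF assms elim(3)] by blast
  qed
  then show ?thesis using cC by (intro exI[of _ "c / 2"] exI[of _ C] conjI allI impI) simp_all
qed

text \<open>The ratio \<open>T S / T (R + L)\<close>, the probability of a return from
  \<open>S\<close> to \<open>R + L\<close>, is at most \<open>1 / (1 + q)\<close> by
  \<open>tail_decay\<close>; hence the correlation ratio is at most
  \<open>1 + 1 / q\<close>.\<close>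

lemma prob_straight_Int_far:
  assumes "1 \<le> R" "R + L < S"
    and tail: "\<And>n. R + L \<le> n \<Longrightarrow> 2 * (B - 1) * T n = (2 * real n + B) * r n"
  defines "q \<equiv> \<Sum>n=R+L..<S. 2 * (B - 1) / (2 * real n + B)"
  shows "0 < q" and "prob (straight R L \<inter> straight S K) \<le> (1 + 1 / q) * prob (straight R L) * prob (straight S K)"
proof -
  define P where "P = (\<Prod>z=R..R+L. E z) * r (R + L)"
  have "P \<ge> 0" unfolding P_def
    using E_pos r_pos by (intro mult_nonneg_nonneg prod_nonneg) (auto simp: less_imp_le)
  show q: "0 < q" unfolding q_def using B_gt_1 assms(2) by (intro sum_pos) auto
  have decay: "T S * (1 + q) \<le> T (R + L)" unfolding q_def using assms by (intro tail_decay) auto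
  have "T (R + L) * q \<le> (T (R + L) - T S) * (1 + q)" using decay by (simp add: algebra_simps)
  moreover have "0 < T (R + L) - T S" using T_less[OF assms(2)] by simp
  ultimately have "1 / (T (R + L) - T S) \<le> (1 + 1 / q) / T (R + L)"
    using q T_pos[of "R + L"] by (simp add: field_simps)
  then have "P * (1 / (T (R + L) - T S)) \<le> P * ((1 + 1 / q) / T (R + L))"
    using \<open>P \<ge> 0\<close> by (rule mult_left_mono)
  moreover have "(\<Prod>z<S. straight_factor R L z) = P * (1 / (T (R + L) - T S))"
    using prod_straight_factor[of R L S] assms by (simp add: P_def)
  moreover have "prob (straight R L) = P / T (R + L)"
    using prob_straight[OF assms(1)] by (simp add: P_def)
  ultimately have "(\<Prod>z<S. straight_factor R L z) \<le> (1 + 1 / q) * prob (straight R L)"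
    by (simp add: mult.commute)
  then have "(\<Prod>z<S. straight_factor R L z) * prob (straight S K)
      \<le> (1 + 1 / q) * prob (straight R L) * prob (straight S K)"
    by (rule mult_right_mono) simp
  then show "prob (straight R L \<inter> straight S K) \<le> (1 + 1 / q) * prob (straight R L) * prob (straight S K)"
    using prob_straight_Int_le[of R S L K] assms by linarith
qed

text \<open>Below \<open>S\<close> the first run is still under way, so each of these
  \<open>S - R\<close> levels costs a factor of at most \<open>e\<close>.\<close>

lemma prob_straight_Int_near:
  assumes "1 \<le> R" "R < S" "S \<le> R + L" and E_le: "\<And>z. R \<le> z \<Longrightarrow> E z \<le> e"
  shows "prob (straight R L \<inter> straight S K) \<le> e ^ (S - R) * prob (straight S K)"
proof -
  have "(\<Prod>z<S. straight_factor R L z) = (\<Prod>z=R..<S. E z)"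
    using assms by (intro prod_straight_factor_run) auto
  also have "\<dots> \<le> (\<Prod>z=R..<S. e)"
    using E_pos by (intro prod_mono) (auto simp: less_imp_le E_le)
  finally have "(\<Prod>z<S. straight_factor R L z) \<le> e ^ (S - R)" by simp
  then have "(\<Prod>z<S. straight_factor R L z) * prob (straight S K) \<le> e ^ (S - R) * prob (straight S K)"
    by (rule mult_right_mono) simp
  then show ?thesis using prob_straight_Int_le[OF assms(2), of L K] by linarith
qed

text \<open>Overlapping runs are charged to \<open>h1\<close>. Disjoint runs either have correlation
  ratio at most \<open>1 + \<delta>\<close> or have \<open>j < K * i\<close>, and the latter are
  charged to \<open>h2\<close>.\<close>

lemma AE_straight_infinitely_often:
  assumes N: "2 \<le> N"
  shows "AE \<omega> in M. infinite {R. \<omega> \<in> straight R (nat \<lfloor>run_f N R 0\<rfloor>)}"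
proof -
  define L where "L R = nat \<lfloor>run_f N R 0\<rfloor>" for R
  have "1 \<le> N" using N by simp
  obtain c C where cC: "0 < c" "0 < C" and bounds':
    "\<And>\<epsilon>. 0 \<le> \<epsilon> \<Longrightarrow> \<forall>\<^sub>F R in sequentially.
       c * (log_weight N (real R) * exp (- \<epsilon> * iter_log N (real R))) \<le> prob (straight R (nat \<lfloor>run_f N R \<epsilon>\<rfloor>))
     \<and> prob (straight R (nat \<lfloor>run_f N R \<epsilon>\<rfloor>)) \<le> C * (log_weight N (real R) * exp (- \<epsilon> * iter_log N (real R)))"
    using eventually_prob_straight_run[OF \<open>1 \<le> N\<close>] by blast
  have bounds: "\<forall>\<^sub>F R in sequentially. c * log_weight N (real R) \<le> prob (straight R (L R))
       \<and> prob (straight R (L R)) \<le> C * log_weight N (real R)"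
    using bounds'[of 0] by (simp add: L_def)
  have "\<forall>\<^sub>F R in sequentially. (c * log_weight N (real R) \<le> prob (straight R (L R))
       \<and> prob (straight R (L R)) \<le> C * log_weight N (real R))
     \<and> log_weight N (real R) \<le> 1 / (real R * ln (real R))
     \<and> 2 * (B - 1) * T R = (2 * real R + B) * r R \<and> E R = 1 / 2 * (1 + B / (2 * real R))
     \<and> (0 \<le> run_f N R 0 \<and> run_f N R 0 + 1 \<le> real R) \<and> max 3 B \<le> real R"
    using bounds eventually_log_weight_le[OF N] eventually_T_eq eventually_E_eq
      eventually_run_f_bounds[OF \<open>1 \<le> N\<close> order_refl]
      eventually_compose_filterlim[OF eventually_ge_at_top[of "max 3 B"] filterlim_real_sequentially]
    by eventually_elim blast
  then obtain R0 where R0: "\<And>R. R0 \<le> R \<Longrightarrow> c * log_weight N (real R) \<le> prob (straight R (L R))"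
      "\<And>R. R0 \<le> R \<Longrightarrow> prob (straight R (L R)) \<le> C * log_weight N (real R)"
      "\<And>R. R0 \<le> R \<Longrightarrow> log_weight N (real R) \<le> 1 / (real R * ln (real R))"
      "\<And>R. R0 \<le> R \<Longrightarrow> 2 * (B - 1) * T R = (2 * real R + B) * r R"
      "\<And>R. R0 \<le> R \<Longrightarrow> E R = 1 / 2 * (1 + B / (2 * real R))"
      "\<And>R. R0 \<le> R \<Longrightarrow> 0 \<le> run_f N R 0 \<and> run_f N R 0 + 1 \<le> real R"
      "\<And>R. R0 \<le> R \<Longrightarrow> max 3 B \<le> real R"
    unfolding eventually_sequentially by blast
  have big: "3 \<le> R" "B \<le> real R" "1 \<le> ln (real R)" if "R0 \<le> R" for R
  proof -
    show "3 \<le> R" "B \<le> real R" using R0(7)[OF that] by auto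
    then have "exp 1 \<le> real R" using exp_le by linarith
    then show "1 \<le> ln (real R)" using \<open>3 \<le> R\<close> by (simp add: ln_ge_iff)
  qed
  have L_less: "Suc (L R) \<le> R" if "R0 \<le> R" for R
  proof -
    have "real (L R) \<le> run_f N R 0" using R0(6)[OF that] by (simp add: L_def)
    then show ?thesis using R0(6)[OF that] by linarith
  qed
  \<comment> \<open>A uniform bound below 1 makes the sums of \<open>h1\<close> geometric;
    \<open>3 / 4\<close> comes from \<open>B \<le> real z\<close>.\<close>
  have E_le: "E z \<le> 3 / 4" if "R0 \<le> z" for z
  proof -
    have "B / (2 * real z) \<le> 1 / 2" using big[OF that] by (simp add: field_simps)
    then show ?thesis using R0(5)[OF that] by simp
  qed
  have prob_le: "prob (straight j (L j)) \<le> C / (real j * ln (real i))" if "R0 \<le> i" "i \<le> j" for i j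
  proof -
    have "R0 \<le> j" using that by simp
    then have "prob (straight j (L j)) \<le> C * (1 / (real j * ln (real j)))"
      using R0(2,3)[of j] cC by (meson mult_left_mono less_imp_le order_trans)
    also have "\<dots> = C / (real j * ln (real j))" by simp
    also have "\<dots> \<le> C / (real j * ln (real i))"
      using big[OF that(1)] big[OF \<open>R0 \<le> j\<close>] that cC
      by (intro divide_left_mono mult_left_mono) auto
    finally show ?thesis .
  qed
  \<comment> \<open>The finitely many small \<open>i\<close>, for which the estimates may fail, get
    the empty event.\<close>
  define A where "A i = (if i < R0 then {} else straight i (L i))" for i
  have A_eq: "A i = straight i (L i)" if "R0 \<le> i" for i using that by (simp add: A_def)
  have "AE \<omega> in M. infinite {n. \<omega> \<in> A n}"
  proof (rule AE_infinitely_often_weak_correlation)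
    show "A n \<in> events" for n by (simp add: A_def)
    show "\<not> summable (\<lambda>n. prob (A n))"
    proof
      assume "summable (\<lambda>n. prob (A n))"
      moreover have "\<forall>\<^sub>F n in sequentially. norm (c * log_weight N (real n)) \<le> prob (A n)"
        using R0(1) cC by (intro eventually_sequentiallyI[of R0]) (simp add: A_eq abs_mult log_weight_pos less_imp_le)
      ultimately have "summable (\<lambda>n. c * log_weight N (real n))"
        by (rule summable_comparison_test_ev[rotated])
      then show False using not_summable_log_weight[of N] cC by (simp add: summable_cmult_iff)
    qed
  next
    fix \<delta> :: real assume \<delta>: "0 < \<delta>"
    \<comment> \<open>If \<open>1 / q > \<delta>\<close>, the logarithmic bound on \<open>q\<close>
      gives \<open>2 * j + B < exp (1 / (\<delta> * (B - 1))) * (6 * i)\<close>, and so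
      \<open>j < K * i\<close>.\<close>
    define K where "K = 3 * exp (1 / (\<delta> * (B - 1)))"
    define D where "D = C * (2 + B) / (2 * (B - 1))"
    have "0 < D" using cC B_gt_1 by (simp add: D_def)
    have "1 \<le> exp (1 / (\<delta> * (B - 1)))" using \<delta> B_gt_1 by simp
    then have "3 \<le> K" unfolding K_def by linarith
    \<comment> \<open>For fixed \<open>j\<close> the sum over \<open>i\<close> is at most
      \<open>4 * prob (A j)\<close>. The diagonal \<open>i = j\<close> is included.\<close>
    define h1 where "h1 i j = (if i \<le> j then (3 / 4) ^ (j - i) * prob (A j) else 0)" for i j
    \<comment> \<open>For fixed \<open>i\<close> the reciprocal distances over the window add up to
      the order of \<open>ln i\<close>, which the factor \<open>1 / ln i\<close>
      compensates.\<close>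
    define h2 where "h2 i j = (if R0 \<le> i \<and> i + L i < j \<and> real j < K * real i
        then prob (A i) * (D / ln (real i) * (1 / (real j - real (i + L i)))) else 0)" for i j
    have h1_nonneg: "0 \<le> h1 i j" for i j by (simp add: h1_def)
    have h2_nonneg: "0 \<le> h2 i j" for i j
    proof -
      have "0 \<le> prob (A i) * (D / ln (real i) * (1 / (real j - real (i + L i))))"
        if "R0 \<le> i" "i + L i < j"
        using \<open>0 < D\<close> big[OF that(1)] that(2)
        by (intro mult_nonneg_nonneg divide_nonneg_nonneg) auto
      then show ?thesis by (simp add: h2_def)
    qed
    have pair: "prob (A i \<inter> A j) \<le> (1 + \<delta>) * prob (A i) * prob (A j) + (h1 i j + h2 i j)" if "i \<le> j" for i j
    proof -
      have main_nonneg: "0 \<le> (1 + \<delta>) * prob (A i) * prob (A j)" using \<delta> by simp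
      consider "i < R0" | "R0 \<le> i" "i = j" | "R0 \<le> i" "i < j" "j \<le> i + L i" | "R0 \<le> i" "i + L i < j"
        using \<open>i \<le> j\<close> by (metis le_neq_implies_less not_less)
      then show ?thesis
      proof cases
        case 1
        then show ?thesis using main_nonneg h1_nonneg[of i j] h2_nonneg[of i j] by (simp add: A_def)
      next
        case 2
        then show ?thesis using main_nonneg h2_nonneg[of i j] by (simp add: h1_def)
      next
        case 3
        then have "prob (A i \<inter> A j) \<le> (3 / 4) ^ (j - i) * prob (A j)"
          using prob_straight_Int_near[of i j "L i" "3 / 4" "L j"] big[of i] E_le by (simp add: A_eq)
        then show ?thesis using main_nonneg h2_nonneg[of i j] 3 by (simp add: h1_def)
      next
        case 4
        define q where "q = (\<Sum>n=i+L i..<j. 2 * (B - 1) / (2 * real n + B))"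
        have ij: "1 \<le> i" "R0 \<le> j" "0 < real j - real (i + L i)" "0 < real j" using big[of i] 4 by auto
        have far: "0 < q" "prob (A i \<inter> A j) \<le> (1 + 1 / q) * prob (A i) * prob (A j)"
          using prob_straight_Int_far(1)[OF ij(1) 4(2)] prob_straight_Int_far(2)[OF ij(1) 4(2), of "L j"]
            R0(4) 4(1) ij(2) by (auto simp: q_def A_eq)
        show ?thesis
        proof (cases "1 / q \<le> \<delta>")
          case True
          then have "(1 + 1 / q) * (prob (A i) * prob (A j)) \<le> (1 + \<delta>) * (prob (A i) * prob (A j))"
            by (intro mult_right_mono) auto
          then show ?thesis using far(2) h1_nonneg[of i j] h2_nonneg[of i j] by (simp add: mult.assoc)
        next
          case False
          then have q_less: "q < 1 / \<delta>" using \<delta> far(1) by (simp add: field_simps)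
          have "(B - 1) * ln ((2 * real j + B) / (2 * real (i + L i) + B)) < 1 / \<delta>"
            using escape_sum_ge(2)[OF 4(2)] q_less by (simp add: q_def)
          then have "ln ((2 * real j + B) / (2 * real (i + L i) + B)) < 1 / (\<delta> * (B - 1))"
            using B_gt_1 \<delta> by (simp add: field_simps)
          moreover have pos: "0 < (2 * real j + B) / (2 * real (i + L i) + B)" "0 < 2 * real (i + L i) + B"
            using B_gt_1 by (auto intro!: divide_pos_pos add_nonneg_pos)
          ultimately have "(2 * real j + B) / (2 * real (i + L i) + B) < exp (1 / (\<delta> * (B - 1)))"
            by (metis exp_less_cancel_iff exp_ln)
          then have "2 * real j + B < exp (1 / (\<delta> * (B - 1))) * (2 * real (i + L i) + B)"
            using pos(2) by (simp add: pos_divide_less_eq)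
          also have "\<dots> \<le> exp (1 / (\<delta> * (B - 1))) * (6 * real i)"
            using L_less[OF 4(1)] big(2)[OF 4(1)] by (intro mult_left_mono) auto
          finally have j_less: "real j < K * real i" using B_gt_1 by (simp add: K_def)
          \<comment> \<open>The linear bound on \<open>q\<close> leaves a factor \<open>j\<close> in
            \<open>1 / q\<close>, which cancels against
            \<open>prob (A j) \<le> C / (j * ln i)\<close>; \<open>D\<close> collects the
            constants.\<close>
          have low: "(real j - real (i + L i)) * (2 * (B - 1) / (2 * real j + B)) \<le> q"
            using escape_sum_ge(1)[OF 4(2)] by (simp add: q_def)
          have den: "0 < (real j - real (i + L i)) * (2 * (B - 1) / (2 * real j + B))"
            using ij B_gt_1 by (intro mult_pos_pos divide_pos_pos) auto
          have "1 / q \<le> 1 / ((real j - real (i + L i)) * (2 * (B - 1) / (2 * real j + B)))"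
            by (rule divide_left_mono[OF low _ mult_pos_pos[OF far(1) den]]) simp
          also have "\<dots> = (2 * real j + B) / (2 * (B - 1)) * (1 / (real j - real (i + L i)))"
            by simp
          also have "\<dots> \<le> (2 + B) * real j / (2 * (B - 1)) * (1 / (real j - real (i + L i)))"
          proof (intro mult_right_mono divide_right_mono)
            have "B * 1 \<le> B * real j" using ij B_gt_1 by (intro mult_left_mono) auto
            then show "2 * real j + B \<le> (2 + B) * real j" by (simp add: algebra_simps)
          qed (use B_gt_1 ij in auto)
          finally have inv_le: "1 / q \<le> (2 + B) * real j / (2 * (B - 1)) * (1 / (real j - real (i + L i)))" .
          have "0 \<le> 1 / q" using far(1) by simp
          have "prob (A j) \<le> C / (real j * ln (real i))"
            using prob_le[OF 4(1), of j] 4 ij(2) by (simp add: A_eq)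
          then have "1 / q * prob (A j)
              \<le> ((2 + B) * real j / (2 * (B - 1)) * (1 / (real j - real (i + L i)))) * (C / (real j * ln (real i)))"
            by (rule mult_mono[OF inv_le _ order_trans[OF \<open>0 \<le> 1 / q\<close> inv_le] measure_nonneg])
          also have "\<dots> = D / ln (real i) * (1 / (real j - real (i + L i)))"
            using ij(4) by (simp add: D_def mult_ac)
          finally have "prob (A i) * (1 / q * prob (A j))
              \<le> prob (A i) * (D / ln (real i) * (1 / (real j - real (i + L i))))"
            by (rule mult_left_mono) simp
          also have "\<dots> = h2 i j" using 4 j_less by (simp add: h2_def)
          finally have "prob (A i) * (1 / q * prob (A j)) \<le> h2 i j" .
          moreover have "0 \<le> \<delta> * (prob (A i) * prob (A j))" using \<delta> by simp
          ultimately show ?thesis using far(2) h1_nonneg[of i j] by (simp add: algebra_simps)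
        qed
      qed
    qed
    have sum_h1: "(\<Sum>i<n. \<Sum>j<n. h1 i j) \<le> 4 * (\<Sum>i<n. prob (A i))" for n
    proof -
      have "(\<Sum>i<n. h1 i j) \<le> 4 * prob (A j)" if "j < n" for j
      proof -
        have "(\<Sum>i<n. h1 i j) = (\<Sum>i\<le>j. (3 / 4) ^ (j - i) * prob (A j))"
          using that by (intro sum.mono_neutral_cong_right) (auto simp: h1_def)
        also have "\<dots> = (\<Sum>k\<le>j. (3 / 4) ^ k) * prob (A j)"
          by (subst sum.nat_diff_reindex[symmetric, of _ "Suc j", unfolded lessThan_Suc_atMost])
             (simp add: sum_distrib_right)
        also have "(\<Sum>k\<le>j. (3 / 4) ^ k) \<le> (4::real)"
          by (simp add: sum_gp0)
        finally show ?thesis by (simp add: mult_right_mono)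
      qed
      then have "(\<Sum>j<n. \<Sum>i<n. h1 i j) \<le> (\<Sum>j<n. 4 * prob (A j))" by (intro sum_mono) auto
      then show ?thesis by (subst sum.swap) (simp add: sum_distrib_left)
    qed
    have sum_h2: "(\<Sum>i<n. \<Sum>j<n. h2 i j) \<le> (D * (2 + ln K)) * (\<Sum>i<n. prob (A i))" for n
    proof -
      have "(\<Sum>j<n. h2 i j) \<le> D * (2 + ln K) * prob (A i)" for i
      proof (cases "R0 \<le> i")
        case True
        define W where "W = {j. j < n \<and> i + L i < j \<and> real j < K * real i}"
        have "(\<Sum>j<n. h2 i j) = (\<Sum>j\<in>W. prob (A i) * (D / ln (real i) * (1 / (real j - real (i + L i)))))"
          using True by (intro sum.mono_neutral_cong_right) (auto simp: h2_def W_def)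
        also have "\<dots> = prob (A i) * (D / ln (real i) * (\<Sum>j\<in>W. 1 / (real j - real (i + L i))))"
          by (simp only: sum_distrib_left)
        also have "\<dots> \<le> prob (A i) * (D / ln (real i) * ((2 + ln K) * ln (real i)))"
        proof (intro mult_left_mono)
          have "1 * 1 \<le> K * real i" using \<open>3 \<le> K\<close> big(1)[OF True] by (intro mult_mono) auto
          then have "(\<Sum>j\<in>W. 1 / (real j - real (i + L i))) \<le> 1 + ln (K * real i)"
            unfolding W_def by (intro sum_window_inverse_le) simp
          also have "\<dots> = 1 + ln K + ln (real i)"
            using \<open>3 \<le> K\<close> big(1)[OF True] by (simp add: ln_mult)
          \<comment> \<open>Here \<open>1 \<le> ln i\<close> absorbs the constant
            \<open>1 + ln K\<close>.\<close>
          also have "\<dots> \<le> (2 + ln K) * ln (real i)"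
          proof -
            have "(1 + ln K) * 1 \<le> (1 + ln K) * ln (real i)"
              using \<open>3 \<le> K\<close> big(3)[OF True] by (intro mult_left_mono) auto
            then show ?thesis by (simp add: algebra_simps)
          qed
          finally show "(\<Sum>j\<in>W. 1 / (real j - real (i + L i))) \<le> (2 + ln K) * ln (real i)" .
        qed (use \<open>0 < D\<close> big(3)[OF True] in auto)
        also have "\<dots> = D * (2 + ln K) * prob (A i)" using big(3)[OF True] by simp
        finally show ?thesis .
      qed (simp add: h2_def A_def)
      then show ?thesis by (simp only: sum_distrib_left) (intro sum_mono)
    qed
    show "\<exists>h C. (\<forall>i j. 0 \<le> h i j) \<and>
        (\<forall>i j. i \<le> j \<longrightarrow> prob (A i \<inter> A j) \<le> (1 + \<delta>) * prob (A i) * prob (A j) + h i j) \<and>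
        (\<forall>n. (\<Sum>i<n. \<Sum>j<n. h i j) \<le> C * (\<Sum>i<n. prob (A i)))"
    proof (intro exI conjI allI impI)
      fix n
      show "(\<Sum>i<n. \<Sum>j<n. h1 i j + h2 i j) \<le> (4 + D * (2 + ln K)) * (\<Sum>i<n. prob (A i))"
        using sum_h1[of n] sum_h2[of n] by (simp only: sum.distrib distrib_right)
    qed (use pair h1_nonneg h2_nonneg in \<open>auto intro: add_nonneg_nonneg\<close>)
  qed
  then show ?thesis
  proof eventually_elim
    case (elim \<omega>)
    have "{n. \<omega> \<in> A n} \<subseteq> {R. \<omega> \<in> straight R (nat \<lfloor>run_f N R 0\<rfloor>)}"
      by (auto simp: A_def L_def split: if_splits)
    then show ?case using elim finite_subset by blast
  qed
qed

text \<open>The factor \<open>exp (- \<epsilon> * iter_log N R)\<close> makes the probabilities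
  summable.\<close>

lemma AE_eventually_not_straight:
  assumes "1 \<le> N" "0 < \<epsilon>"
  shows "AE \<omega> in M. \<forall>\<^sub>F R in sequentially. \<omega> \<notin> straight R (nat \<lfloor>run_f N R \<epsilon>\<rfloor>)"
proof -
  obtain c C where "0 < C" and bound: "\<forall>\<^sub>F R in sequentially.
       c * (log_weight N (real R) * exp (- \<epsilon> * iter_log N (real R))) \<le> prob (straight R (nat \<lfloor>run_f N R \<epsilon>\<rfloor>))
     \<and> prob (straight R (nat \<lfloor>run_f N R \<epsilon>\<rfloor>)) \<le> C * (log_weight N (real R) * exp (- \<epsilon> * iter_log N (real R)))"
    using eventually_prob_straight_run[OF assms(1)] less_imp_le[OF assms(2)] by blast
  have "summable (\<lambda>R. prob (straight R (nat \<lfloor>run_f N R \<epsilon>\<rfloor>)))"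
  proof (rule summable_comparison_test_ev)
    show "\<forall>\<^sub>F R in sequentially. norm (prob (straight R (nat \<lfloor>run_f N R \<epsilon>\<rfloor>)))
        \<le> C * (log_weight N (real R) * exp (- \<epsilon> * iter_log N (real R)))"
      using bound by eventually_elim simp
    show "summable (\<lambda>R. C * (log_weight N (real R) * exp (- \<epsilon> * iter_log N (real R))))"
      using summable_log_weight_exp[OF assms(2)] by (rule summable_mult)
  qed
  then have "AE \<omega> in M. \<forall>\<^sub>F R in sequentially. \<omega> \<in> space M - straight R (nat \<lfloor>run_f N R \<epsilon>\<rfloor>)"
    by (intro borel_cantelli_AE1) (auto simp: less_top[symmetric])
  then show ?thesis by eventually_elim (auto elim: eventually_mono)
qed

lemma AE_infinite_runs:
  assumes "2 \<le> N"
  shows "AE \<omega> in M. infinite {R. \<forall>j. int j \<le> \<lfloor>run_g N R\<rfloor> \<longrightarrow> local_time X (R + j) \<omega> = 1}"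
  using AE_straight_infinitely_often[OF assms] AE_transient_path
proof eventually_elim
  case (elim \<omega>)
  have "{R. \<omega> \<in> straight R (nat \<lfloor>run_f N R 0\<rfloor>)}
      \<subseteq> {R. \<forall>j. int j \<le> \<lfloor>run_g N R\<rfloor> \<longrightarrow> local_time X (R + j) \<omega> = 1}"
    using local_time_eq_1_if_above_barrier[of X \<omega>, OF elim(2)] by (auto simp: straight_def run_g_def)
  then show ?case using elim(1) finite_subset by blast
qed

text \<open>The values \<open>1 / (m + 1)\<close> of \<open>\<epsilon>\<close> give a single null
  set for all \<open>\<epsilon>\<close>, because \<open>run_f\<close> increases with
  \<open>\<epsilon>\<close> for large \<open>R\<close>, so a site found within the smaller window
  also lies in the larger one.\<close>

lemma AE_eventually_short_runs:
  assumes "1 \<le> N"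
  shows "AE \<omega> in M. \<forall>\<epsilon>>0. \<forall>\<^sub>F R in sequentially. \<exists>S.
    real R \<le> real S \<and> real S \<le> real R + run_f N R \<epsilon> \<and> 1 < local_time X S \<omega>"
proof -
  have "AE \<omega> in M. \<forall>m. \<forall>\<^sub>F R in sequentially. \<omega> \<notin> straight R (nat \<lfloor>run_f N R (inverse (real (Suc m)))\<rfloor>)"
    unfolding AE_all_countable using AE_eventually_not_straight[OF assms] by simp
  then show ?thesis
    using AE_transient_path AE_space
  proof eventually_elim
    case (elim \<omega>)
    show ?case
    proof (intro allI impI)
      fix \<epsilon> :: real assume "0 < \<epsilon>"
      then obtain m where m: "inverse (real (Suc m)) < \<epsilon>" using reals_Archimedean by blast
      define \<eta> where "\<eta> = inverse (real (Suc m))"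
      have \<eta>: "0 \<le> \<eta>" "\<eta> < \<epsilon>" using m by (simp_all add: \<eta>_def)
      have "\<forall>\<^sub>F R in sequentially. \<omega> \<notin> straight R (nat \<lfloor>run_f N R \<eta>\<rfloor>)"
        using elim(1) by (simp add: \<eta>_def)
      then show "\<forall>\<^sub>F R in sequentially. \<exists>S. real R \<le> real S \<and> real S \<le> real R + run_f N R \<epsilon> \<and> 1 < local_time X S \<omega>"
        using eventually_run_f_bounds[OF assms \<eta>(1)] eventually_iter_log_pos[of N 0]
      proof eventually_elim
        case (elim R)
        define L where "L = nat \<lfloor>run_f N R \<eta>\<rfloor>"
        have "\<not> above_barrier (straight_barrier R L) (\<lambda>k. X k \<omega>)"
          using elim(1) \<open>\<omega> \<in> space M\<close> by (simp add: straight_def L_def)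
        then obtain S where S: "R \<le> S" "S \<le> R + L" "1 < local_time X S \<omega>"
          using above_barrier_if_local_time_le_1[of X \<omega>, OF \<open>transient_path (\<lambda>k. X k \<omega>)\<close>, of R L]
          by (metis not_le_imp_less)
        have "real L \<le> run_f N R \<eta>" using elim(2) by (simp add: L_def)
        also have "\<dots> \<le> run_f N R \<epsilon>"
          unfolding run_f_def using \<eta> elim(3)
          by (intro mult_left_mono add_left_mono mult_right_mono) (auto intro: less_imp_le)
        finally show ?case using S by (intro exI[of _ S]) auto
      qed
    qed
  qed
qed

end

theorem theorem3p4:
  fixes B :: real and N :: nat and M :: "'a measure" and X :: "nat \<Rightarrow> 'a \<Rightarrow> nat"
  assumes "B > 1" and "N \<ge> 2" and "nn_walk M (drift B) X"
  shows "(AE \<omega> in M. infinite {R::nat. \<forall>j::nat. int j \<le> \<lfloor>run_g N R\<rfloor> \<longrightarrow>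
             local_time X (R + j) \<omega> = 1})
       \<and> (AE \<omega> in M. \<forall>\<epsilon>>0. \<forall>\<^sub>F R::nat in at_top. \<exists>S::nat.
             real R \<le> real S \<and> real S \<le> real R + run_f N R \<epsilon> \<and> local_time X S \<omega> > 1)"
proof -
  interpret drift_walk M B X
    using assms by (simp add: drift_walk_def drift_walk_axioms_def)
  show ?thesis
    using AE_infinite_runs[OF assms(2)] AE_eventually_short_runs[of N] assms(2) by simp
qed

end
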